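(* The function $u_\infty\in C_0^{0,s}(\overline\Omega)$, extended as zero outside $\Omega$, is both a viscosity supersolution of the problem $$\mathcal{L}_\infty u=0\ \text{ in }\Omega,\qquad u=0\ \text{ in }\mathbb{R}^N\setminus\Omega,$$ and a viscosity solution of the problem $$\mathcal{L}_\infty^- u+|u_\infty|_s=0\ \text{ in }\Omega,\qquad u=0\ \text{ in }\mathbb{R}^N\setminus\Omega.$$ Moreover, $u_\infty$ is strictly positive in $\Omega$ and the only minimizers of $|\cdot|_s$ on $\mathcal{M}_s$ are $-v_s$ and $v_s$.
   Context: Let $\Omega\subset\mathbb{R}^N$ be a bounded domain with smooth (at least Lipschitz) boundary, and let $s\in(0,1)$ be fixed. The weight $\omega$ satisfies $\omega\in C(\Omega)\cap L^r(\Omega)$ for some $r>1$, $\omega>0$ in $\Omega$, and $\int_\Omega\omega\,\mathrm{d}x=1$. For $p>1$, $[u]_{s,p}:=\left(\int_{\mathbb{R}^N}\int_{\mathbb{R}^N}\frac{|u(x)-u(y)|^p}{|x-y|^{N+sp}}\mathrm{d}x\mathrm{d}y\right)^{1/p}$ and $W_0^{s,p}(\Omega):=\{u\in L^p(\mathbb{R}^N): u=0 \text{ in }\mathbb{R}^N\setminus\Omega,\ [u]_{s,p}<\infty\}$. Put $k(u):=\exp\left(\int_\Omega(\log|u|)\,\omega\,\mathrm{d}x\right)$ (with $\log 0=-\infty$, $\exp(-\infty)=0$), $\mathcal{M}_p:=\{u\in W_0^{s,p}(\Omega):\int_\Omega(\log|u|)\omega\,\mathrm{d}x=0\}$ and $\Lambda_p:=\inf\{[u]_{s,p}^p:u\in\mathcal{M}_p\}$.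 For each $p>1$, $0<\Lambda_p<\infty$ is attained by a function $u_p\in\mathcal{M}_p$, $u_p>0$ in $\Omega$, which is the only positive function in $W_0^{s,p}(\Omega)$ satisfying $$\int_{\mathbb{R}^N}\int_{\mathbb{R}^N}\frac{|u_p(x)-u_p(y)|^{p-2}(u_p(x)-u_p(y))(\varphi(x)-\varphi(y))}{|x-y|^{N+sp}}\mathrm{d}x\mathrm{d}y=\Lambda_p\int_\Omega u_p^{-1}\varphi\,\omega\,\mathrm{d}x\quad\forall\varphi\in W_0^{s,p}(\Omega).$$ $C_0^{0,s}(\overline\Omega)$ is the space of $s$-Hölder continuous functions on $\overline\Omega$ vanishing on $\partial\Omega$, with norm $|u|_s:=\sup_{x\ne y\in\overline\Omega}\frac{|u(x)-u(y)|}{|x-y|^s}$. $\mathcal{M}_s:=\{u\in C_0^{0,s}(\overline\Omega):k(u)=1\}$, and $v_s$ denotes the unique nonnegative minimizer of $|\cdot|_s$ on $\mathcal{M}_s$ (it exists and is unique). $u_\infty$ denotes a limit function of the family $\{u_p\}$: there is a sequence $p_n\to\infty$ such that $u_{p_n}\to u_\infty$ uniformly in $\overline\Omega$. Such limits exist (every sequence $p_n\to\infty$ has a subsequence along which $u_{p_n}$ converges uniformly), $0\le u_\infty\in C_0^{0,s}(\overline\Omega)$, $|u_\infty|_s=\lim_n\sqrt[p_n]{\Lambda_{p_n}}$, and $v_s=k(u_\infty)^{-1}u_\infty$ with $k(u_\infty)\ge1$. Operators: $(\mathcal{L}_\infty^+u)(x):=\sup_{y\in\mathbb{R}^N\setminus\{x\}}\frac{u(y)-u(x)}{|y-x|^s}$,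 $(\mathcal{L}_\infty^-u)(x):=\inf_{y\in\mathbb{R}^N\setminus\{x\}}\frac{u(y)-u(x)}{|y-x|^s}$, $\mathcal{L}_\infty:=\mathcal{L}_\infty^++\mathcal{L}_\infty^-$. Viscosity notions: let $\mathcal{L}$ be either $\mathcal{L}u=\mathcal{L}_\infty u$ or $\mathcal{L}u=\mathcal{L}_\infty^-u+|u_\infty|_s$ (with $|u_\infty|_s$ a fixed constant), and consider $\mathcal{L}u=0$ in $\Omega$, $u=0$ in $\mathbb{R}^N\setminus\Omega$. Let $u\in C(\mathbb{R}^N)$ with $u>0$ in $\Omega$ and $u=0$ in $\mathbb{R}^N\setminus\Omega$. $u$ is a viscosity supersolution if $(\mathcal{L}\varphi)(x_0)\le0$ for all $(x_0,\varphi)\in\Omega\times C_0^1(\mathbb{R}^N)$ with $\varphi(x_0)=u(x_0)$ and $\varphi\le u$ in $\mathbb{R}^N$; a viscosity subsolution if $(\mathcal{L}\varphi)(x_0)\ge0$ for all $(x_0,\varphi)\in\Omega\times C_0^1(\mathbb{R}^N)$ with $\varphi(x_0)=u(x_0)$ and $\varphi\ge u$ in $\mathbb{R}^N$; a viscosity solution if it is both. Here $C_0^1(\mathbb{R}^N)$ denotes $C^1$ functions with compact support. *)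

theory Defs
  imports "HOL-Analysis.Analysis"
begin

text \<open>
  Euclidean space of dimension N is an arbitrary type of class \<^class>\<open>euclidean_space\<close>
  with N given by its dimension. All functions are total; functions on a domain are extended by
  zero, and elements of Lebesgue spaces are Borel representatives.
\<close>

text \<open>
  Locally, after a rotation, the domain is the part of a ball above the graph of a Lipschitz
  function. The unit vector e is the vertical direction, and the graph function lives on the
  hyperplane orthogonal to e.
\<close>

definition lipschitz_boundary :: "'a::euclidean_space set \<Rightarrow> bool" where
  "lipschitz_boundary \<Omega> \<longleftrightarrow>
     (\<forall>x0\<in>frontier \<Omega>. \<exists>e \<gamma> L r. norm e = 1 \<and> r > 0 \<and> L-lipschitz_on {z. z \<bullet> e = 0} \<gamma> \<and>
        \<Omega> \<inter> ball x0 r = {x \<in> ball x0 r. \<gamma> (x - (x \<bullet> e) *\<^sub>R e) < x \<bullet> e})"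

definition bounded_lipschitz_domain :: "'a::euclidean_space set \<Rightarrow> bool" where
  "bounded_lipschitz_domain \<Omega> \<longleftrightarrow>
     open \<Omega> \<and> connected \<Omega> \<and> \<Omega> \<noteq> {} \<and> bounded \<Omega> \<and> lipschitz_boundary \<Omega>"

definition admissible_weight :: "'a::euclidean_space set \<Rightarrow> ('a \<Rightarrow> real) \<Rightarrow> bool" where
  "admissible_weight \<Omega> \<omega> \<longleftrightarrow>
     continuous_on \<Omega> \<omega> \<and> (\<exists>r>1. set_integrable lborel \<Omega> (\<lambda>x. \<bar>\<omega> x\<bar> powr r)) \<and>
     (\<forall>x\<in>\<Omega>. \<omega> x > 0) \<and> (LINT x:\<Omega>|lborel. \<omega> x) = 1"

subsection \<open>The logarithmic mean\<close>

definition ereal_ln :: "real \<Rightarrow> ereal" where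
  "ereal_ln t = (if t = 0 then -\<infinity> else ereal (ln t))"

definition ereal_exp :: "ereal \<Rightarrow> ereal" where
  "ereal_exp a = (if a = -\<infinity> then 0 else if a = \<infinity> then \<infinity> else ereal (exp (real_of_ereal a)))"

text \<open>
  The integral over the domain of log |u| with weight \<open>\<omega>\<close>, as an extended real: integral of the
  positive part minus integral of the negative part (\<^const>\<open>e2ennreal\<close> truncates at 0). The first
  integral is finite for every u in some Lebesgue space of positive exponent, so that
  infinity minus infinity does not occur below.
\<close>

definition log_integral :: "'a::euclidean_space set \<Rightarrow> ('a \<Rightarrow> real) \<Rightarrow> ('a \<Rightarrow> real) \<Rightarrow> ereal" where
  "log_integral \<Omega> \<omega> u =
     enn2ereal (\<integral>\<^sup>+x\<in>\<Omega>. e2ennreal (ereal_ln \<bar>u x\<bar>) * ennreal (\<omega> x) \<partial>lborel) -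
     enn2ereal (\<integral>\<^sup>+x\<in>\<Omega>. e2ennreal (- ereal_ln \<bar>u x\<bar>) * ennreal (\<omega> x) \<partial>lborel)"

definition log_mean :: "'a::euclidean_space set \<Rightarrow> ('a \<Rightarrow> real) \<Rightarrow> ('a \<Rightarrow> real) \<Rightarrow> ereal" where
  "log_mean \<Omega> \<omega> u = ereal_exp (log_integral \<Omega> \<omega> u)"

subsection \<open>Fractional Sobolev spaces\<close>

definition gagliardo_energy :: "real \<Rightarrow> real \<Rightarrow> ('a::euclidean_space \<Rightarrow> real) \<Rightarrow> ennreal" where
  "gagliardo_energy s p u =
     (\<integral>\<^sup>+x. \<integral>\<^sup>+y. ennreal (\<bar>u x - u y\<bar> powr p / norm (x - y) powr (real DIM('a) + s * p))
        \<partial>lborel \<partial>lborel)"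

definition gagliardo_seminorm :: "real \<Rightarrow> real \<Rightarrow> ('a::euclidean_space \<Rightarrow> real) \<Rightarrow> real" where
  "gagliardo_seminorm s p u = enn2real (gagliardo_energy s p u) powr (1 / p)"

definition sobolev_zero ::
    "real \<Rightarrow> real \<Rightarrow> 'a::euclidean_space set \<Rightarrow> ('a \<Rightarrow> real) set" where
  "sobolev_zero s p \<Omega> =
     {u. u \<in> borel_measurable borel \<and> integrable lborel (\<lambda>x. \<bar>u x\<bar> powr p) \<and>
         (\<forall>x. x \<notin> \<Omega> \<longrightarrow> u x = 0) \<and> gagliardo_energy s p u < \<infinity>}"

definition constraint_p ::
    "real \<Rightarrow> real \<Rightarrow> 'a::euclidean_space set \<Rightarrow> ('a \<Rightarrow> real) \<Rightarrow> ('a \<Rightarrow> real) set" where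
  "constraint_p s p \<Omega> \<omega> = {u \<in> sobolev_zero s p \<Omega>. log_integral \<Omega> \<omega> u = 0}"

definition Lambda ::
    "real \<Rightarrow> real \<Rightarrow> 'a::euclidean_space set \<Rightarrow> ('a \<Rightarrow> real) \<Rightarrow> real" where
  "Lambda s p \<Omega> \<omega> = (INF u\<in>constraint_p s p \<Omega> \<omega>. gagliardo_seminorm s p u powr p)"

text \<open>
  The last integrability condition makes the right-hand side meaningful, since Bochner integrals of
  non-integrable functions are 0. On the left, integrability on the product space is automatic by
  Hoelder's inequality.
\<close>

definition weak_solution ::
    "real \<Rightarrow> real \<Rightarrow> 'a::euclidean_space set \<Rightarrow> ('a \<Rightarrow> real) \<Rightarrow> ('a \<Rightarrow> real) \<Rightarrow> bool" where
  "weak_solution s p \<Omega> \<omega> u \<longleftrightarrow>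
     (\<forall>\<phi>\<in>sobolev_zero s p \<Omega>.
        set_integrable lborel \<Omega> (\<lambda>x. inverse (u x) * \<phi> x * \<omega> x) \<and>
        (LINT x|lborel. LINT y|lborel.
           \<bar>u x - u y\<bar> powr (p - 2) * (u x - u y) * (\<phi> x - \<phi> y)
             / norm (x - y) powr (real DIM('a) + s * p))
        = Lambda s p \<Omega> \<omega> * (LINT x:\<Omega>|lborel. inverse (u x) * \<phi> x * \<omega> x))"

text \<open>
  The functions \<open>u\<^sub>p\<close>. In the range \<open>s p > N\<close>, where every element of the Sobolev space has a
  continuous representative by Morrey's inequality, that representative is meant.
\<close>

definition extremal ::
    "real \<Rightarrow> real \<Rightarrow> 'a::euclidean_space set \<Rightarrow> ('a \<Rightarrow> real) \<Rightarrow> ('a \<Rightarrow> real) \<Rightarrow> bool" where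
  "extremal s p \<Omega> \<omega> u \<longleftrightarrow>
     u \<in> constraint_p s p \<Omega> \<omega> \<and> gagliardo_seminorm s p u powr p = Lambda s p \<Omega> \<omega> \<and>
     (\<forall>x\<in>\<Omega>. u x > 0) \<and> weak_solution s p \<Omega> \<omega> u \<and>
     (s * p > real DIM('a) \<longrightarrow> continuous_on UNIV u)"

subsection \<open>Hoelder spaces\<close>

definition holder_zero :: "real \<Rightarrow> 'a::euclidean_space set \<Rightarrow> ('a \<Rightarrow> real) set" where
  "holder_zero s \<Omega> =
     {u. (\<forall>x. x \<notin> \<Omega> \<longrightarrow> u x = 0) \<and>
         (\<exists>C. \<forall>x\<in>closure \<Omega>. \<forall>y\<in>closure \<Omega>. \<bar>u x - u y\<bar> \<le> C * norm (x - y) powr s)}"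

definition holder_norm :: "real \<Rightarrow> 'a::euclidean_space set \<Rightarrow> ('a \<Rightarrow> real) \<Rightarrow> real" where
  "holder_norm s \<Omega> u =
     Sup {\<bar>u x - u y\<bar> / norm (x - y) powr s |x y. x \<in> closure \<Omega> \<and> y \<in> closure \<Omega> \<and> x \<noteq> y}"

definition constraint_s ::
    "real \<Rightarrow> 'a::euclidean_space set \<Rightarrow> ('a \<Rightarrow> real) \<Rightarrow> ('a \<Rightarrow> real) set" where
  "constraint_s s \<Omega> \<omega> = {u \<in> holder_zero s \<Omega>. log_mean \<Omega> \<omega> u = 1}"

abbreviation holder_minimizer ::
    "real \<Rightarrow> 'a::euclidean_space set \<Rightarrow> ('a \<Rightarrow> real) \<Rightarrow> ('a \<Rightarrow> real) \<Rightarrow> bool" where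
  "holder_minimizer s \<Omega> \<omega> \<equiv> is_arg_min (holder_norm s \<Omega>) (\<lambda>u. u \<in> constraint_s s \<Omega> \<omega>)"

subsection \<open>Infinity operators and viscosity solutions\<close>

definition L_inf_plus :: "real \<Rightarrow> ('a::euclidean_space \<Rightarrow> real) \<Rightarrow> 'a \<Rightarrow> real" where
  "L_inf_plus s u x = (SUP y\<in>UNIV - {x}. (u y - u x) / norm (y - x) powr s)"

definition L_inf_minus :: "real \<Rightarrow> ('a::euclidean_space \<Rightarrow> real) \<Rightarrow> 'a \<Rightarrow> real" where
  "L_inf_minus s u x = (INF y\<in>UNIV - {x}. (u y - u x) / norm (y - x) powr s)"

definition L_inf :: "real \<Rightarrow> ('a::euclidean_space \<Rightarrow> real) \<Rightarrow> 'a \<Rightarrow> real" where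
  "L_inf s u x = L_inf_plus s u x + L_inf_minus s u x"

definition C1_compact_support :: "('a::euclidean_space \<Rightarrow> real) set" where
  "C1_compact_support =
     {\<phi>. (\<exists>g. continuous_on UNIV g \<and> (\<forall>x. (\<phi> has_derivative (\<lambda>h. g x \<bullet> h)) (at x))) \<and>
         compact (closure {x. \<phi> x \<noteq> 0})}"

text \<open>
  The operator is only ever applied to test functions, for which the supremum and infimum above
  are finite.
\<close>

definition viscosity_candidate :: "'a::euclidean_space set \<Rightarrow> ('a \<Rightarrow> real) \<Rightarrow> bool" where
  "viscosity_candidate \<Omega> u \<longleftrightarrow>
     continuous_on UNIV u \<and> (\<forall>x\<in>\<Omega>. u x > 0) \<and> (\<forall>x. x \<notin> \<Omega> \<longrightarrow> u x = 0)"

definition viscosity_supersolution ::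
    "'a::euclidean_space set \<Rightarrow> (('a \<Rightarrow> real) \<Rightarrow> 'a \<Rightarrow> real) \<Rightarrow> ('a \<Rightarrow> real) \<Rightarrow> bool" where
  "viscosity_supersolution \<Omega> L u \<longleftrightarrow> viscosity_candidate \<Omega> u \<and>
     (\<forall>x0\<in>\<Omega>. \<forall>\<phi>\<in>C1_compact_support. \<phi> x0 = u x0 \<and> (\<forall>x. \<phi> x \<le> u x) \<longrightarrow> L \<phi> x0 \<le> 0)"

definition viscosity_subsolution ::
    "'a::euclidean_space set \<Rightarrow> (('a \<Rightarrow> real) \<Rightarrow> 'a \<Rightarrow> real) \<Rightarrow> ('a \<Rightarrow> real) \<Rightarrow> bool" where
  "viscosity_subsolution \<Omega> L u \<longleftrightarrow> viscosity_candidate \<Omega> u \<and>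
     (\<forall>x0\<in>\<Omega>. \<forall>\<phi>\<in>C1_compact_support. \<phi> x0 = u x0 \<and> (\<forall>x. \<phi> x \<ge> u x) \<longrightarrow> L \<phi> x0 \<ge> 0)"

definition viscosity_solution ::
    "'a::euclidean_space set \<Rightarrow> (('a \<Rightarrow> real) \<Rightarrow> 'a \<Rightarrow> real) \<Rightarrow> ('a \<Rightarrow> real) \<Rightarrow> bool" where
  "viscosity_solution \<Omega> L u \<longleftrightarrow> viscosity_supersolution \<Omega> L u \<and> viscosity_subsolution \<Omega> L u"

end

theory Submission
  imports Defs "HOL-Probability.Sinc_Integral"
begin

text \<open>
  Write \<open>d x\<close> for the distance from \<open>x\<close> to the complement of \<open>\<Omega>\<close>. The limit and the minimizer are both equal
  to the explicit function \<open>\<Lambda> d\<^sup>s\<close>, where \<open>\<Lambda> = exp (- s \<integral> ln d \<omega>)\<close> is the constant that makes its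
  logarithmic mean 1; each claim is then read off from this formula.

  A function \<open>w\<close> of the Hoelder space satisfies \<open>\<bar>w\<bar> \<le> \<bar>w\<bar>\<^sub>s d\<^sup>s\<close> (compare with a nearest point outside
  \<open>\<Omega>\<close>), and \<open>d\<^sup>s\<close> itself has Hoelder norm 1, because \<open>\<bar>a\<^sup>s - b\<^sup>s\<bar> \<le> \<bar>a - b\<bar>\<^sup>s\<close>. So if \<open>w\<close> has
  logarithmic mean 1, then its norm is at least \<open>\<Lambda>\<close>, and if the norm equals \<open>\<Lambda>\<close>, then
  \<open>\<bar>w\<bar> = \<Lambda> d\<^sup>s\<close> (\<open>abs_eq_profile\<close>). As \<open>\<Omega>\<close> is connected and \<open>w\<close> does not vanish in it, \<open>w\<close> has one sign,
  which leaves the two minimizers \<open>\<plusminus> \<Lambda> d\<^sup>s\<close> (\<open>minimizers_eq_profile\<close>). That \<open>\<integral> ln d \<omega>\<close> is finite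
  follows from the existence of one function in the constraint set (\<open>integrable_ln_bdist\<close>).

  For the limit, two estimates on the energy suffice. From above, the functions \<open>c d\<^sup>t\<close> with \<open>t > s\<close>
  are competitors: the gain \<open>t - s\<close> in the exponent removes, for large \<open>p\<close>, the singularity of the kernel on the diagonal, and
  letting \<open>t\<close> decrease to \<open>s\<close> shows that the minimal energy is eventually at most \<open>K a\<^sup>p\<close> for each
  \<open>a > \<Lambda>\<close> (\<open>Lambda_growth\<close>). From below, a difference quotient of the limit larger than \<open>M > a\<close>
  at one pair of points would persist on a product of two balls and force the energy to be at least \<open>\<kappa> M\<^sup>p\<close>
  with \<open>\<kappa> > 0\<close> (\<open>holder_bound_of_energy_growth\<close>). Hence the limit has Hoelder constant at most \<open>\<Lambda>\<close>,
  so it is at most \<open>\<Lambda> d\<^sup>s\<close>; and being a uniform limit of functions of logarithmic mean 1 it cannot be smaller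
  anywhere, by \<open>abs_eq_profile\<close> again.

  Finally, let a test function touch \<open>K d\<^sup>s\<close> at \<open>x\<close>. Its difference quotients at \<open>x\<close> are bounded on one
  side by those of \<open>K d\<^sup>s\<close>, which lie in \<open>[-K, K]\<close>; if it touches from below, then its quotient at a nearest
  point outside \<open>\<Omega>\<close> is at most \<open>-K\<close>. These bounds are exactly the viscosity inequalities
  (\<open>cone_profile_supersolution\<close>, \<open>cone_profile_solution\<close>).
\<close>

section \<open>Distance to the boundary and Hoelder functions\<close>

text \<open>
  The power is subadditive because its quotient by the identity is decreasing.
\<close>

lemma abs_powr_diff_le:
  fixes a b t :: real
  assumes "0 \<le> a" "0 \<le> b" "0 < t" "t \<le> 1"
  shows "\<bar>a powr t - b powr t\<bar> \<le> \<bar>a - b\<bar> powr t"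
proof -
  have sub: "(x + y) powr t \<le> x powr t + y powr t" if "0 \<le> x" "0 \<le> y" for x y :: real
  proof (cases "x = 0 \<or> y = 0")
    case False
    with that have pos: "0 < x" "0 < y" by auto
    have split: "z powr t = z * z powr (t - 1)" if "0 < z" for z :: real
      using that by (simp add: powr_mult_base)
    have "(x + y) powr t = x * (x + y) powr (t - 1) + y * (x + y) powr (t - 1)"
      using pos by (simp add: split[of "x + y"] distrib_right)
    also have "\<dots> \<le> x * x powr (t - 1) + y * y powr (t - 1)"
      using pos assms by (intro add_mono mult_left_mono powr_mono2') auto
    also have "\<dots> = x powr t + y powr t"
      using pos by (simp add: split)
    finally show ?thesis .
  qed auto
  have ord: "\<bar>a powr t - b powr t\<bar> \<le> \<bar>a - b\<bar> powr t" if "0 \<le> b" "b \<le> a" for a b :: real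
    using sub[of b "a - b"] powr_mono2[of t b a] that assms by auto
  show ?thesis
    using ord[of a b] ord[of b a] assms by (cases "b \<le> a") (auto simp: abs_minus_commute)
qed

locale bounded_open_set =
  fixes \<Omega> :: "'a::euclidean_space set"
  assumes open_domain: "open \<Omega>" and bounded_domain: "bounded \<Omega>" and domain_nonempty: "\<Omega> \<noteq> {}"
begin

abbreviation bdist :: "'a \<Rightarrow> real" where
  "bdist x \<equiv> infdist x (- \<Omega>)"

lemma compl_nonempty: "- \<Omega> \<noteq> {}"
  using bounded_domain not_bounded_UNIV by (metis Compl_empty_eq double_compl)

lemma bdist_pos: "x \<in> \<Omega> \<Longrightarrow> 0 < bdist x"
  using open_domain compl_nonempty by (intro infdist_pos_not_in_closed) auto

lemma bdist_outside: "x \<notin> \<Omega> \<Longrightarrow> bdist x = 0"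
  by simp

lemma domain_measurable [measurable]: "\<Omega> \<in> sets borel"
  using open_domain by simp

lemma bdist_measurable [measurable]: "bdist \<in> borel_measurable borel"
  by (intro borel_measurable_continuous_onI continuous_intros)

text \<open>
  The nearest point lies in the closure of the domain since the open ball reaching up to it is contained
  in the domain. The Hoelder norm compares only points of the closure.
\<close>

lemma nearest_point:
  assumes "x \<in> \<Omega>"
  obtains y where "y \<notin> \<Omega>" "y \<in> closure \<Omega>" "norm (x - y) = bdist x" "y \<noteq> x"
proof -
  obtain y where y: "y \<in> - \<Omega>" "bdist x = dist x y"
    using infdist_attains_inf[of "- \<Omega>" x] compl_nonempty open_domain by auto
  have "ball x (bdist x) \<subseteq> \<Omega>"
  proof
    fix z assume "z \<in> ball x (bdist x)"
    then show "z \<in> \<Omega>"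
      using infdist_le[of z "- \<Omega>" x] by (cases "z \<in> \<Omega>") auto
  qed
  then have "closure (ball x (bdist x)) \<subseteq> closure \<Omega>"
    by (rule closure_mono)
  then have "cball x (bdist x) \<subseteq> closure \<Omega>"
    using bdist_pos[OF assms] by simp
  then have "y \<in> closure \<Omega>"
    using y(2) by auto
  moreover have "norm (x - y) = bdist x" "y \<noteq> x" "y \<notin> \<Omega>"
    using y assms by (auto simp: dist_norm)
  ultimately show ?thesis by (intro that)
qed

lemma bdist_powr_holder:
  assumes "0 < t" "t \<le> 1"
  shows "\<bar>bdist x powr t - bdist y powr t\<bar> \<le> norm (x - y) powr t"
proof -
  have "\<bar>bdist x powr t - bdist y powr t\<bar> \<le> \<bar>bdist x - bdist y\<bar> powr t"
    using assms by (intro abs_powr_diff_le) (auto simp: infdist_nonneg)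
  also have "\<dots> \<le> norm (x - y) powr t"
    using assms infdist_triangle_abs[of x "- \<Omega>" y] by (intro powr_mono2) (auto simp: dist_norm)
  finally show ?thesis .
qed

lemma bdist_bounded: obtains D where "1 \<le> D" "\<And>x. bdist x \<le> D"
proof -
  obtain a where a: "a \<in> - \<Omega>" using compl_nonempty by auto
  obtain B where B: "\<And>x. x \<in> \<Omega> \<Longrightarrow> dist a x \<le> B"
    using bounded_domain by (auto simp: bounded_any_center[where a = a])
  have "bdist x \<le> max 1 B" for x
  proof (cases "x \<in> \<Omega>")
    case True
    then show ?thesis using infdist_le[OF a, of x] B[OF True] by (simp add: dist_commute)
  qed (simp add: bdist_outside)
  then show ?thesis using that[of "max 1 B"] by auto
qed

lemma holder_norm_bound:
  assumes "w \<in> holder_zero s \<Omega>" "x \<in> closure \<Omega>" "y \<in> closure \<Omega>"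
  shows "\<bar>w x - w y\<bar> \<le> holder_norm s \<Omega> w * norm (x - y) powr s"
proof (cases "x = y")
  case False
  obtain C where C: "\<And>x y. x \<in> closure \<Omega> \<Longrightarrow> y \<in> closure \<Omega> \<Longrightarrow>
      \<bar>w x - w y\<bar> \<le> C * norm (x - y) powr s"
    using assms by (auto simp: holder_zero_def)
  have "\<bar>w x - w y\<bar> / norm (x - y) powr s \<le> holder_norm s \<Omega> w"
    unfolding holder_norm_def
  proof (rule cSup_upper)
    show "bdd_above {\<bar>w x - w y\<bar> / norm (x - y) powr s |x y.
        x \<in> closure \<Omega> \<and> y \<in> closure \<Omega> \<and> x \<noteq> y}"
      using C by (intro bdd_aboveI[where M = C]) (fastforce simp: divide_le_eq)
    show "\<bar>w x - w y\<bar> / norm (x - y) powr s \<in> {\<bar>w x - w y\<bar> / norm (x - y) powr s |x y.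
        x \<in> closure \<Omega> \<and> y \<in> closure \<Omega> \<and> x \<noteq> y}"
      using assms False by blast
  qed
  then show ?thesis using False by (simp add: divide_le_eq)
qed auto

lemma holder_norm_least:
  assumes "\<And>x y. x \<in> closure \<Omega> \<Longrightarrow> y \<in> closure \<Omega> \<Longrightarrow> \<bar>w x - w y\<bar> \<le> C * norm (x - y) powr s"
  shows "holder_norm s \<Omega> w \<le> C"
  unfolding holder_norm_def
proof (rule cSup_least)
  obtain x where "x \<in> \<Omega>" using domain_nonempty by auto
  moreover obtain y where "y \<in> closure \<Omega>" "y \<noteq> x"
    by (rule nearest_point[OF \<open>x \<in> \<Omega>\<close>])
  moreover have "x \<in> closure \<Omega>"
    using \<open>x \<in> \<Omega>\<close> closure_subset by blast
  ultimately show "{\<bar>w x - w y\<bar> / norm (x - y) powr s |x y.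
      x \<in> closure \<Omega> \<and> y \<in> closure \<Omega> \<and> x \<noteq> y} \<noteq> {}"
    by blast
next
  fix q assume "q \<in> {\<bar>w x - w y\<bar> / norm (x - y) powr s |x y.
      x \<in> closure \<Omega> \<and> y \<in> closure \<Omega> \<and> x \<noteq> y}"
  then obtain x y where "q = \<bar>w x - w y\<bar> / norm (x - y) powr s"
    "x \<in> closure \<Omega>" "y \<in> closure \<Omega>" "x \<noteq> y" by blast
  then show "q \<le> C"
    using assms[of x y] by (simp add: divide_le_eq)
qed

lemma holder_norm_uminus: "holder_norm s \<Omega> (\<lambda>x. - w x) = holder_norm s \<Omega> w"
proof -
  have "\<bar>- w x - - w y\<bar> = \<bar>w x - w y\<bar>" for x y by simp
  then show ?thesis by (simp only: holder_norm_def)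
qed

text \<open>
  At a nearest point outside the domain the function is 0, so the Hoelder estimate for this
  pair of points is a bound on the value.
\<close>

lemma holder_zero_le_bdist:
  assumes "w \<in> holder_zero s \<Omega>"
  shows "\<bar>w x\<bar> \<le> holder_norm s \<Omega> w * bdist x powr s"
proof (cases "x \<in> \<Omega>")
  case True
  obtain y where y: "y \<notin> \<Omega>" "y \<in> closure \<Omega>" "norm (x - y) = bdist x"
    by (rule nearest_point[OF True])
  have "w y = 0" using assms y by (auto simp: holder_zero_def)
  then show ?thesis
    using holder_norm_bound[OF assms, of x y] y True closure_subset[of \<Omega>] by auto
qed (use assms in \<open>auto simp: holder_zero_def\<close>)

text \<open>
  Conversely, the power of the distance attains equality in the preceding bound.
\<close>

lemma bdist_multiple_holder:
  assumes "0 < s" "s \<le> 1" "0 \<le> K"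
  shows "(\<lambda>x. K * bdist x powr s) \<in> holder_zero s \<Omega>"
    and "holder_norm s \<Omega> (\<lambda>x. K * bdist x powr s) = K"
proof -
  let ?w = "\<lambda>x. K * bdist x powr s"
  have *: "\<bar>?w x - ?w y\<bar> \<le> K * norm (x - y) powr s" for x y
  proof -
    have "\<bar>?w x - ?w y\<bar> = K * \<bar>bdist x powr s - bdist y powr s\<bar>"
      using assms by (simp add: abs_mult flip: right_diff_distrib)
    then show ?thesis
      using bdist_powr_holder[of s x y] assms by (simp add: mult_left_mono)
  qed
  then show mem: "?w \<in> holder_zero s \<Omega>"
    using assms by (auto simp: holder_zero_def)
  obtain x where x: "x \<in> \<Omega>" using domain_nonempty by auto
  have "K * bdist x powr s \<le> holder_norm s \<Omega> ?w * bdist x powr s"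
    using holder_zero_le_bdist[OF mem, of x] assms by simp
  then have "K \<le> holder_norm s \<Omega> ?w"
    using bdist_pos[OF x] by simp
  then show "holder_norm s \<Omega> ?w = K"
    by (intro antisym holder_norm_least *)
qed

lemma holder_zero_continuous:
  assumes "w \<in> holder_zero s \<Omega>" "0 < s"
  shows "continuous_on \<Omega> w"
proof -
  have "((\<lambda>y. w y) \<longlongrightarrow> w x) (at x within \<Omega>)" if "x \<in> \<Omega>" for x
  proof -
    have "((\<lambda>y. holder_norm s \<Omega> w * norm (y - x) powr s) \<longlongrightarrow> holder_norm s \<Omega> w * norm (x - x) powr s)
        (at x within \<Omega>)"
      using assms(2) by (intro tendsto_intros tendsto_powr2) auto
    then have "((\<lambda>y. holder_norm s \<Omega> w * norm (y - x) powr s) \<longlongrightarrow> 0) (at x within \<Omega>)"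
      by simp
    moreover have "\<forall>\<^sub>F y in at x within \<Omega>. norm (w y - w x) \<le> holder_norm s \<Omega> w * norm (y - x) powr s"
      using holder_norm_bound[OF assms(1)] that closure_subset[of \<Omega>]
      by (auto simp: eventually_at_filter subset_iff intro!: always_eventually)
    ultimately show ?thesis
      by (subst LIM_zero_iff[symmetric]) (rule Lim_null_comparison)
  qed
  then show ?thesis by (simp add: continuous_on_def)
qed

lemma holder_zero_measurable:
  assumes "w \<in> holder_zero s \<Omega>" "0 < s"
  shows "w \<in> borel_measurable borel"
proof -
  have "w = (\<lambda>x. indicator \<Omega> x *\<^sub>R w x)"
    using assms by (auto simp: holder_zero_def indicator_def fun_eq_iff)
  then show ?thesis
    using borel_measurable_continuous_on_indicator[OF domain_measurable holder_zero_continuous[OF assms]]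
    by simp
qed

end

section \<open>The viscosity inequalities for multiples of a power of the distance\<close>

text \<open>
  An infimum of reals is only a lower bound of its set if the set is bounded below. Close to x, differentiability
  bounds the quotient, as the exponent s is at most 1; far from x, boundedness of the test function does.
\<close>

lemma C1_compact_quotient_bdd_below:
  fixes \<phi> :: "'a::euclidean_space \<Rightarrow> real"
  assumes "\<phi> \<in> C1_compact_support" "0 < s" "s \<le> 1"
  shows "bdd_below ((\<lambda>y. (\<phi> y - \<phi> x) / norm (y - x) powr s) ` (UNIV - {x}))"
proof -
  obtain g where g: "\<And>x. (\<phi> has_derivative (\<lambda>h. g x \<bullet> h)) (at x)"
    and cpt: "compact (closure {x. \<phi> x \<noteq> 0})"
    using assms(1) by (auto simp: C1_compact_support_def)
  have "continuous_on (closure {x. \<phi> x \<noteq> 0}) \<phi>"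
    by (rule has_derivative_continuous_on[OF has_derivative_at_withinI[OF g]])
  then have "bounded (\<phi> ` closure {x. \<phi> x \<noteq> 0})"
    using cpt by (intro compact_imp_bounded compact_continuous_image)
  then obtain B where B: "0 < B" "\<And>y. y \<in> closure {x. \<phi> x \<noteq> 0} \<Longrightarrow> \<bar>\<phi> y\<bar> \<le> B"
    by (auto simp: bounded_pos)
  have B': "\<bar>\<phi> y\<bar> \<le> B" for y
    using B closure_subset[of "{x. \<phi> x \<noteq> 0}"] by (cases "\<phi> y = 0") auto
  obtain \<delta> where \<delta>: "0 < \<delta>"
    "\<And>y. norm (y - x) < \<delta> \<Longrightarrow> norm (\<phi> y - \<phi> x - g x \<bullet> (y - x)) \<le> 1 * norm (y - x)"
    using g[of x] unfolding has_derivative_at_alt by (metis zero_less_one)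
  define \<eta> where "\<eta> = min \<delta> 1"
  have \<eta>: "0 < \<eta>" "\<eta> \<le> \<delta>" "\<eta> \<le> 1" using \<delta> by (auto simp: \<eta>_def)
  define C where "C = max (norm (g x) + 1) (2 * B / \<eta> powr s)"
  have "\<bar>\<phi> y - \<phi> x\<bar> \<le> C * norm (y - x) powr s" if "y \<noteq> x" for y
  proof (cases "norm (y - x) < \<eta>")
    case True
    have "\<bar>\<phi> y - \<phi> x\<bar> \<le> \<bar>g x \<bullet> (y - x)\<bar> + norm (y - x)"
      using \<delta>(2)[of y] True \<eta> by auto
    also have "\<dots> \<le> (norm (g x) + 1) * norm (y - x)"
      using Cauchy_Schwarz_ineq2[of "g x" "y - x"] by (simp add: algebra_simps)
    also have "norm (y - x) = norm (y - x) powr 1" by simp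
    also have "\<dots> \<le> norm (y - x) powr s"
      using True \<eta> assms by (intro powr_mono') auto
    also have "(norm (g x) + 1) * norm (y - x) powr s \<le> C * norm (y - x) powr s"
      by (intro mult_right_mono) (auto simp: C_def)
    finally show ?thesis by (simp add: mult_left_mono)
  next
    case False
    have "\<bar>\<phi> y - \<phi> x\<bar> \<le> 2 * B" using B'[of x] B'[of y] by linarith
    also have "\<dots> = 2 * B / \<eta> powr s * \<eta> powr s" using \<eta> by simp
    also have "\<dots> \<le> C * norm (y - x) powr s"
      using False \<eta> assms B by (intro mult_mono powr_mono2) (auto simp: C_def intro: max.coboundedI1)
    finally show ?thesis .
  qed
  then have "- (C * norm (y - x) powr s) \<le> \<phi> y - \<phi> x" if "y \<noteq> x" for y
    using that by (fastforce dest: abs_le_D2)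
  then have "- C \<le> (\<phi> y - \<phi> x) / norm (y - x) powr s" if "y \<noteq> x" for y
    using that by (simp add: le_divide_eq)
  then show ?thesis by (intro bdd_belowI2[where m = "- C"]) auto
qed

context bounded_open_set
begin

context
  fixes s K :: real
  assumes s: "0 < s" "s \<le> 1" and K: "0 < K"
begin

definition "cone_profile x = K * bdist x powr s"

lemma cone_profile_candidate: "viscosity_candidate \<Omega> cone_profile"
proof -
  have "continuous_on UNIV cone_profile"
    unfolding cone_profile_def using s
    by (intro continuous_intros continuous_on_powr') (auto simp: infdist_nonneg)
  then show ?thesis
    using bdist_pos K by (force simp: viscosity_candidate_def cone_profile_def)
qed

lemma cone_profile_holder: "\<bar>cone_profile x - cone_profile y\<bar> \<le> K * norm (x - y) powr s"
proof -
  have "\<bar>cone_profile x - cone_profile y\<bar> = K * \<bar>bdist x powr s - bdist y powr s\<bar>"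
    using K by (simp add: cone_profile_def abs_mult flip: right_diff_distrib)
  then show ?thesis
    using bdist_powr_holder[OF s, of x y] K by (simp add: mult_left_mono)
qed

text \<open>
  The quotient at a nearest point outside the domain is already at most - K.
\<close>

lemma L_inf_minus_touching_below:
  assumes "x \<in> \<Omega>" "\<phi> \<in> C1_compact_support" "\<phi> x = cone_profile x" "\<And>y. \<phi> y \<le> cone_profile y"
  shows "L_inf_minus s \<phi> x \<le> - K"
proof -
  obtain y where y: "y \<notin> \<Omega>" "norm (x - y) = bdist x" "y \<noteq> x"
    by (rule nearest_point[OF assms(1)])
  have "L_inf_minus s \<phi> x \<le> (\<phi> y - \<phi> x) / norm (y - x) powr s"
    unfolding L_inf_minus_def using y
    by (intro cINF_lower C1_compact_quotient_bdd_below assms s) auto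
  also have "\<dots> \<le> (0 - K * bdist x powr s) / norm (y - x) powr s"
    using assms(3) assms(4)[of y] y by (intro divide_right_mono) (auto simp: cone_profile_def)
  also have "\<dots> = - K"
    using y bdist_pos[OF assms(1)] by (simp add: norm_minus_commute)
  finally show ?thesis .
qed

lemma L_inf_plus_touching_below:
  assumes "\<phi> x = cone_profile x" "\<And>y. \<phi> y \<le> cone_profile y"
  shows "L_inf_plus s \<phi> x \<le> K"
  unfolding L_inf_plus_def
proof (rule cSUP_least)
  fix y assume "y \<in> UNIV - {x}"
  then show "(\<phi> y - \<phi> x) / norm (y - x) powr s \<le> K"
    using cone_profile_holder[of y x] assms(1) assms(2)[of y] by (simp add: divide_le_eq)
qed (use UNIV_not_singleton[of x] in auto)

lemma L_inf_minus_touching_above: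
  assumes "\<phi> x = cone_profile x" "\<And>y. cone_profile y \<le> \<phi> y"
  shows "- K \<le> L_inf_minus s \<phi> x"
  unfolding L_inf_minus_def
proof (rule cINF_greatest)
  fix y assume "y \<in> UNIV - {x}"
  then show "- K \<le> (\<phi> y - \<phi> x) / norm (y - x) powr s"
    using cone_profile_holder[of y x] assms(1) assms(2)[of y] by (simp add: le_divide_eq)
qed (use UNIV_not_singleton[of x] in auto)

lemma cone_profile_supersolution: "viscosity_supersolution \<Omega> (L_inf s) cone_profile"
  unfolding viscosity_supersolution_def
proof (intro conjI ballI impI cone_profile_candidate)
  fix x \<phi>
  assume "x \<in> \<Omega>" "\<phi> \<in> C1_compact_support" "\<phi> x = cone_profile x \<and> (\<forall>y. \<phi> y \<le> cone_profile y)"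
  then show "L_inf s \<phi> x \<le> 0"
    using L_inf_minus_touching_below[of x \<phi>] L_inf_plus_touching_below[of \<phi> x]
    by (simp add: L_inf_def)
qed

lemma cone_profile_solution:
  "viscosity_solution \<Omega> (\<lambda>\<phi> x. L_inf_minus s \<phi> x + K) cone_profile"
  unfolding viscosity_solution_def viscosity_supersolution_def viscosity_subsolution_def
proof (intro conjI ballI impI cone_profile_candidate)
  fix x \<phi>
  assume "x \<in> \<Omega>" "\<phi> \<in> C1_compact_support" "\<phi> x = cone_profile x \<and> (\<forall>y. \<phi> y \<le> cone_profile y)"
  then show "L_inf_minus s \<phi> x + K \<le> 0"
    using L_inf_minus_touching_below[of x \<phi>] by simp
next
  fix x \<phi>
  assume "\<phi> x = cone_profile x \<and> (\<forall>y. cone_profile y \<le> \<phi> y)"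
  then show "0 \<le> L_inf_minus s \<phi> x + K"
    using L_inf_minus_touching_above[of \<phi> x] by simp
qed

end

end

section \<open>The logarithmic mean as an integral over a probability space\<close>

locale weighted_domain = bounded_open_set \<Omega>
  for \<Omega> :: "'a::euclidean_space set" +
  fixes \<omega> :: "'a \<Rightarrow> real"
  assumes weight: "admissible_weight \<Omega> \<omega>"
begin

definition \<mu> :: "'a measure" where
  "\<mu> = density lborel (\<lambda>x. ennreal (indicator \<Omega> x * \<omega> x))"

lemma weight_measurable [measurable]: "(\<lambda>x. indicator \<Omega> x * \<omega> x) \<in> borel_measurable borel"
  using weight borel_measurable_continuous_on_indicator[of \<Omega> \<omega>]
  by (simp add: admissible_weight_def)

lemma weight_pos: "x \<in> \<Omega> \<Longrightarrow> 0 < \<omega> x"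
  using weight by (simp add: admissible_weight_def)

lemma weight_nonneg: "0 \<le> indicator \<Omega> x * \<omega> x"
  using weight_pos[of x] by (cases "x \<in> \<Omega>") auto

lemma sets_\<mu> [measurable_cong, simp]: "sets \<mu> = sets borel"
  by (simp add: \<mu>_def)

lemma space_\<mu> [simp]: "space \<mu> = UNIV"
  by (simp add: \<mu>_def)

lemma weight_integral: "(\<integral>x. indicator \<Omega> x * \<omega> x \<partial>lborel) = 1"
  using weight by (simp add: admissible_weight_def set_lebesgue_integral_def)

lemma prob_space_\<mu>: "prob_space \<mu>"
proof
  have int: "integrable lborel (\<lambda>x. indicator \<Omega> x * \<omega> x)"
    using weight_integral not_integrable_integral_eq by fastforce
  have "emeasure \<mu> (space \<mu>) = (\<integral>\<^sup>+x. ennreal (indicator \<Omega> x * \<omega> x) \<partial>lborel)"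
    by (simp add: \<mu>_def emeasure_density)
  also have "\<dots> = 1"
    using nn_integral_eq_integral[OF int] weight_nonneg weight_integral by simp
  finally show "emeasure \<mu> (space \<mu>) = 1" .
qed

sublocale \<mu>: prob_space \<mu>
  by (rule prob_space_\<mu>)

lemma AE_\<mu>_domain: "AE x in \<mu>. x \<in> \<Omega>"
proof -
  have "(\<lambda>x. ennreal (indicator \<Omega> x * \<omega> x)) \<in> borel_measurable lborel" by measurable
  then show ?thesis
    unfolding \<mu>_def by (subst AE_density) (auto split: split_indicator)
qed

lemma AE_\<mu>_imp_lborel:
  assumes "AE x in \<mu>. P x"
  shows "AE x in lborel. x \<in> \<Omega> \<longrightarrow> P x"
proof -
  have "AE x in lborel. 0 < ennreal (indicator \<Omega> x * \<omega> x) \<longrightarrow> P x"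
    using assms unfolding \<mu>_def by (subst (asm) AE_density) auto
  then show ?thesis
    using weight_pos by (auto elim!: eventually_mono)
qed

lemma \<mu>_ball_pos:
  assumes "0 < r" "ball x r \<subseteq> \<Omega>"
  shows "0 < measure \<mu> (ball x r)"
proof (rule ccontr)
  assume "\<not> 0 < measure \<mu> (ball x r)"
  then have "emeasure \<mu> (ball x r) = 0"
    using \<mu>.emeasure_eq_measure[of "ball x r"] measure_nonneg[of \<mu> "ball x r"] by simp
  then have "AE y in \<mu>. y \<notin> ball x r"
    by (intro AE_not_in) auto
  then have "AE y in lborel. y \<in> \<Omega> \<longrightarrow> y \<notin> ball x r"
    by (rule AE_\<mu>_imp_lborel)
  then have "AE y in lborel. y \<notin> ball x r"
    using assms(2) by (auto elim!: eventually_mono)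
  then have "emeasure lborel (ball x r) = 0"
    by (subst (asm) AE_iff_null_sets[symmetric]) auto
  then show False
    using content_ball_pos[OF assms(1), of x] by (simp add: measure_def)
qed

lemma ereal_ln_measurable [measurable]: "ereal_ln \<in> borel_measurable borel"
  unfolding ereal_ln_def by measurable

lemma log_integral_\<mu>:
  assumes [measurable]: "u \<in> borel_measurable borel"
  shows "log_integral \<Omega> \<omega> u =
    enn2ereal (\<integral>\<^sup>+x. e2ennreal (ereal_ln \<bar>u x\<bar>) \<partial>\<mu>) -
    enn2ereal (\<integral>\<^sup>+x. e2ennreal (- ereal_ln \<bar>u x\<bar>) \<partial>\<mu>)"
proof -
  have "(\<integral>\<^sup>+x\<in>\<Omega>. g x * ennreal (\<omega> x) \<partial>lborel) = (\<integral>\<^sup>+x. g x \<partial>\<mu>)"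
    if [measurable]: "g \<in> borel_measurable borel" for g
  proof -
    have "(\<lambda>x. ennreal (indicator \<Omega> x * \<omega> x)) \<in> borel_measurable lborel"
      "g \<in> borel_measurable lborel" by measurable
    then show ?thesis
      unfolding \<mu>_def
      by (subst nn_integral_density)
        (auto intro!: nn_integral_cong split: split_indicator simp: mult.commute)
  qed
  then show ?thesis
    by (simp add: log_integral_def)
qed

text \<open>
  The value 0 excludes that the negative part of the logarithm has an infinite integral, and
  also that both parts have one, since infinity minus infinity is infinity in the extended reals. Therefore the
  logarithmic integral is an ordinary integral.
\<close>

lemma log_integral_zeroD:
  assumes [measurable]: "u \<in> borel_measurable borel" and zero: "log_integral \<Omega> \<omega> u = 0"
  shows "AE x in \<mu>. u x \<noteq> 0" "integrable \<mu> (\<lambda>x. ln \<bar>u x\<bar>)" "(\<integral>x. ln \<bar>u x\<bar> \<partial>\<mu>) = 0"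
proof -
  define P where "P = (\<integral>\<^sup>+x. e2ennreal (ereal_ln \<bar>u x\<bar>) \<partial>\<mu>)"
  define N where "N = (\<integral>\<^sup>+x. e2ennreal (- ereal_ln \<bar>u x\<bar>) \<partial>\<mu>)"
  have diff: "enn2ereal P - enn2ereal N = 0"
    using zero by (simp add: log_integral_\<mu> P_def N_def)
  have fin: "P \<noteq> \<infinity>" "N \<noteq> \<infinity>" and eq: "P = N"
    using diff by (cases P; cases N; simp)+
  have "AE x in \<mu>. e2ennreal (- ereal_ln \<bar>u x\<bar>) \<noteq> \<infinity>"
    using fin(2) unfolding N_def by (intro nn_integral_PInf_AE) auto
  then show nz: "AE x in \<mu>. u x \<noteq> 0"
    by (auto simp: ereal_ln_def elim!: eventually_mono)
  have P: "P = (\<integral>\<^sup>+x. ennreal (ln \<bar>u x\<bar>) \<partial>\<mu>)" and N: "N = (\<integral>\<^sup>+x. ennreal (- ln \<bar>u x\<bar>) \<partial>\<mu>)"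
    unfolding P_def N_def using nz
    by (auto intro!: nn_integral_cong_AE simp: ereal_ln_def elim!: eventually_mono)
  show int: "integrable \<mu> (\<lambda>x. ln \<bar>u x\<bar>)"
    using fin by (simp add: real_integrable_def P N)
  show "(\<integral>x. ln \<bar>u x\<bar> \<partial>\<mu>) = 0"
    using eq by (simp add: real_lebesgue_integral_def[OF int] flip: P N)
qed

lemma log_integral_eq_integral:
  assumes [measurable]: "u \<in> borel_measurable borel" and nz: "\<And>x. x \<in> \<Omega> \<Longrightarrow> u x \<noteq> 0"
    and int: "integrable \<mu> (\<lambda>x. ln \<bar>u x\<bar>)"
  shows "log_integral \<Omega> \<omega> u = ereal (\<integral>x. ln \<bar>u x\<bar> \<partial>\<mu>)"
proof -
  define P where "P = (\<integral>\<^sup>+x. ennreal (ln \<bar>u x\<bar>) \<partial>\<mu>)"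
  define N where "N = (\<integral>\<^sup>+x. ennreal (- ln \<bar>u x\<bar>) \<partial>\<mu>)"
  have fin: "P \<noteq> \<infinity>" "N \<noteq> \<infinity>"
    using int by (simp_all add: real_integrable_def P_def N_def)
  have "(\<integral>\<^sup>+x. e2ennreal (ereal_ln \<bar>u x\<bar>) \<partial>\<mu>) = P" "(\<integral>\<^sup>+x. e2ennreal (- ereal_ln \<bar>u x\<bar>) \<partial>\<mu>) = N"
    unfolding P_def N_def using AE_\<mu>_domain
    by (auto intro!: nn_integral_cong_AE simp: ereal_ln_def nz elim!: eventually_mono)
  then have "log_integral \<Omega> \<omega> u = enn2ereal P - enn2ereal N"
    by (simp add: log_integral_\<mu>)
  also have "\<dots> = ereal (enn2real P - enn2real N)"
    using fin by (cases P; cases N) auto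
  also have "enn2real P - enn2real N = (\<integral>x. ln \<bar>u x\<bar> \<partial>\<mu>)"
    by (simp add: real_lebesgue_integral_def[OF int] P_def N_def)
  finally show ?thesis .
qed

lemma log_mean_eq_1_iff: "log_mean \<Omega> \<omega> u = 1 \<longleftrightarrow> log_integral \<Omega> \<omega> u = 0"
  unfolding log_mean_def ereal_exp_def
  by (cases "log_integral \<Omega> \<omega> u") (auto simp: one_ereal_def zero_ereal_def)

text \<open>
  The logarithm of the distance lies between a constant and an affine function of \<open>ln \<bar>v\<bar>\<close>, the latter by
  \<open>holder_zero_le_bdist\<close>.
\<close>

lemma integrable_ln_bdist:
  assumes "0 < s" "v \<in> constraint_s s \<Omega> \<omega>"
  shows "integrable \<mu> (\<lambda>x. ln (bdist x))"
proof -
  have v: "v \<in> holder_zero s \<Omega>" and zero: "log_integral \<Omega> \<omega> v = 0"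
    using assms by (auto simp: constraint_s_def log_mean_eq_1_iff)
  have [measurable]: "v \<in> borel_measurable borel"
    by (rule holder_zero_measurable[OF v assms(1)])
  note log = log_integral_zeroD[OF _ zero, simplified]
  obtain D where D: "1 \<le> D" "\<And>x. bdist x \<le> D" using bdist_bounded by blast
  define C where "C = max 1 (holder_norm s \<Omega> v)"
  have C: "1 \<le> C" "\<bar>v x\<bar> \<le> C * bdist x powr s" for x
    using holder_zero_le_bdist[OF v, of x]
      mult_right_mono[of "holder_norm s \<Omega> v" C "bdist x powr s"]
    by (auto simp: C_def)
  show ?thesis
  proof (rule Bochner_Integration.integrable_bound)
    show "integrable \<mu> (\<lambda>x. \<bar>ln \<bar>v x\<bar>\<bar> / s + \<bar>ln C\<bar> / s + ln D)"
      using log(2) by auto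
    show "AE x in \<mu>. norm (ln (bdist x)) \<le> norm (\<bar>ln \<bar>v x\<bar>\<bar> / s + \<bar>ln C\<bar> / s + ln D)"
      using log(1) AE_\<mu>_domain
    proof eventually_elim
      fix x assume x: "v x \<noteq> 0" "x \<in> \<Omega>"
      note pos = bdist_pos[OF x(2)]
      have up: "ln (bdist x) \<le> ln D" using pos D by simp
      have "ln \<bar>v x\<bar> \<le> ln (C * bdist x powr s)"
        using x C pos by (subst ln_le_cancel_iff) auto
      also have "\<dots> = ln C + s * ln (bdist x)"
        using C pos by (simp add: ln_mult ln_powr)
      finally have "- ln (bdist x) \<le> (ln C - ln \<bar>v x\<bar>) / s"
        using assms(1) by (simp add: field_simps)
      also have "\<dots> \<le> (\<bar>ln \<bar>v x\<bar>\<bar> + \<bar>ln C\<bar>) / s"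
        using assms(1) by (intro divide_right_mono) auto
      finally have lo: "- ln (bdist x) \<le> \<bar>ln \<bar>v x\<bar>\<bar> / s + \<bar>ln C\<bar> / s"
        by (simp add: add_divide_distrib)
      have nn: "0 \<le> \<bar>ln \<bar>v x\<bar>\<bar> / s + \<bar>ln C\<bar> / s" "0 \<le> ln D"
        using assms(1) D by auto
      show "norm (ln (bdist x)) \<le> norm (\<bar>ln \<bar>v x\<bar>\<bar> / s + \<bar>ln C\<bar> / s + ln D)"
        using up lo nn unfolding real_norm_def by linarith
    qed
  qed simp
qed

end

section \<open>Upper bounds on the energy\<close>

text \<open>
  A product of one-dimensional Cauchy densities, up to a constant. It decays no faster than the power
  \<open>- 2 N\<close> of the norm and is easy to integrate; multiples of it
  dominate the integrands of the energies below.
\<close>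

definition cauchy_weight :: "'a::euclidean_space \<Rightarrow> real" where
  "cauchy_weight z = (\<Prod>b\<in>Basis. inverse (1 + (z \<bullet> b)\<^sup>2))"

lemma cauchy_weight_measurable [measurable]: "cauchy_weight \<in> borel_measurable borel"
  unfolding cauchy_weight_def by measurable

lemma cauchy_weight_minus_commute: "cauchy_weight (x - y) = cauchy_weight (y - x)"
  by (simp add: cauchy_weight_def inner_diff_left power2_commute)

lemma nn_integral_cauchy_weight_finite:
  "(\<integral>\<^sup>+z. ennreal (cauchy_weight (z::'a::euclidean_space)) \<partial>lborel) < \<infinity>"
proof -
  have nonneg: "0 \<le> inverse (1 + t\<^sup>2)" for t :: real
    by (simp add: add_nonneg_nonneg)
  have "integrable lborel (\<lambda>t::real. inverse (1 + t\<^sup>2))"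
    using integrable_inverse_1_plus_square by (simp add: set_integrable_def)
  then have "(\<integral>\<^sup>+t. ennreal (inverse (1 + t\<^sup>2)) \<partial>(lborel :: real measure)) < \<infinity>"
    using nonneg by (simp add: integrable_iff_bounded)
  moreover have "(\<integral>\<^sup>+z. ennreal (cauchy_weight (z::'a)) \<partial>lborel) =
      (\<Prod>b\<in>(Basis::'a set). \<integral>\<^sup>+t. ennreal (inverse (1 + t\<^sup>2)) \<partial>lborel)"
    using nn_integral_lborel_prod[of "\<lambda>b t. ennreal (inverse (1 + t\<^sup>2))"] nonneg
    by (simp add: cauchy_weight_def prod_ennreal)
  ultimately show ?thesis
    by (simp add: power_less_top_ennreal)
qed

lemma cauchy_weight_lower:
  fixes z :: "'a::euclidean_space"
  shows "1 / (1 + (norm z)\<^sup>2) ^ DIM('a) \<le> cauchy_weight z"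
proof -
  have "(\<Prod>b\<in>(Basis::'a set). inverse (1 + (norm z)\<^sup>2)) \<le> cauchy_weight z"
    unfolding cauchy_weight_def
  proof (intro prod_mono conjI le_imp_inverse_le)
    fix b :: 'a assume "b \<in> Basis"
    then have "(z \<bullet> b)\<^sup>2 \<le> (norm z)\<^sup>2"
      by (simp add: abs_le_square_iff[symmetric] Basis_le_norm)
    then show "1 + (z \<bullet> b)\<^sup>2 \<le> 1 + (norm z)\<^sup>2" by simp
  qed (auto simp: add_nonneg_nonneg add_pos_nonneg)
  then show ?thesis by (simp add: divide_inverse power_inverse)
qed

text \<open>
  Here h stands for the difference of the values at two points whose difference is z. For \<open>norm z \<le> D\<close> the
  Hoelder bound with the better exponent t compensates the singularity of the kernel; for \<open>norm z > D\<close> the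
  uniform bound on h is the better one, and part of the decay of the kernel is spent to keep the base of the
  p-th power equal to \<open>c D\<^bsup>t - s\<^esup>\<close> in both cases.
\<close>

lemma gagliardo_integrand_bound:
  fixes z :: "'a::euclidean_space"
  assumes "0 < s" "s < t" "1 \<le> D" "0 \<le> c" "0 < p"
    and p: "real DIM('a) \<le> (t - s) * p" "real DIM('a) \<le> s * p"
    and h: "0 \<le> h" "h \<le> c * norm z powr t" "h \<le> c * D powr t"
  shows "h powr p / norm z powr (real DIM('a) + s * p)
    \<le> (c * D powr (t - s)) powr p * (2 * D) ^ DIM('a) * cauchy_weight z"
proof (cases "z = 0")
  case True
  then show ?thesis
    using assms by (simp add: cauchy_weight_def prod_nonneg)
next
  case False
  define r where "r = norm z"
  define N where "N = DIM('a)"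
  have r: "0 < r" using False by (simp add: r_def)
  note p = p[folded N_def]
  \<comment> \<open>With \<open>m = max r D\<close> both cases give the same bound, which decays like \<open>r\<^bsup>- 2 N\<^esup>\<close>.\<close>
  define m where "m = max r D"
  have m: "0 < m" "r \<le> m" "D \<le> m" "1 \<le> m" using r assms by (auto simp: m_def)
  have main: "h powr p / r powr (N + s * p) \<le> (c * D powr (t - s)) powr p * (D ^ N / m ^ (2 * N))"
  proof (cases "r \<le> D")
    case True
    have "h powr p / r powr (N + s * p) \<le> (c * r powr t) powr p / r powr (N + s * p)"
      using assms h r by (intro divide_right_mono powr_mono2) (auto simp: r_def)
    also have "\<dots> = c powr p * r powr (t * p - (N + s * p))"
      using assms r by (simp add: powr_mult powr_powr powr_diff)
    also have "t * p - (N + s * p) = (t - s) * p - N"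
      by (simp add: algebra_simps)
    also have "c powr p * r powr ((t - s) * p - N) \<le> c powr p * D powr ((t - s) * p - N)"
      using True r p by (intro mult_left_mono powr_mono2) auto
    also have "\<dots> = (c * D powr (t - s)) powr p * (D ^ N / D ^ (2 * N))"
      using assms by (simp add: powr_mult powr_powr powr_diff[of D "(t - s) * p"] powr_realpow mult_2 power_add)
    finally show ?thesis using True by (simp add: m_def)
  next
    case False
    have "h powr p / r powr (N + s * p) \<le> (c * D powr t) powr p / r powr (N + s * p)"
      using assms h r by (intro divide_right_mono powr_mono2) auto
    also have "\<dots> = (c * D powr t) powr p * (r powr (- (s * p - N)) / r ^ (2 * N))"
      using r by (simp add: powr_realpow[symmetric] powr_diff[symmetric] divide_inverse
          powr_minus[symmetric] powr_add[symmetric] algebra_simps)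
    also have "\<dots> \<le> (c * D powr t) powr p * (D powr (- (s * p - N)) / r ^ (2 * N))"
      using False r p assms
      by (intro mult_left_mono divide_right_mono powr_mono2') auto
    also have "(c * D powr t) powr p = (c * D powr (t - s)) powr p * D powr (s * p)"
      using assms by (simp add: powr_mult powr_powr powr_add[symmetric] algebra_simps)
    also have "\<dots> * (D powr (- (s * p - N)) / r ^ (2 * N)) = (c * D powr (t - s)) powr p * (D ^ N / r ^ (2 * N))"
      using assms by (simp add: powr_realpow[symmetric] powr_add[symmetric])
    finally show ?thesis using False by (simp add: m_def)
  qed
  have "D ^ N / m ^ (2 * N) = (2 * D) ^ N * (1 / (2 * m\<^sup>2) ^ N)"
    using m by (simp add: power_mult_distrib power_mult)
  also have "\<dots> \<le> (2 * D) ^ N * (1 / (1 + r\<^sup>2) ^ N)"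
  proof -
    have "r\<^sup>2 \<le> m\<^sup>2" "1 \<le> m\<^sup>2"
      using power_mono[of r m 2] one_le_power[of m 2] m r by auto
    then have "1 + r\<^sup>2 \<le> 2 * m\<^sup>2" by linarith
    then show ?thesis
      using assms m r by (intro mult_left_mono divide_left_mono power_mono mult_pos_pos zero_less_power)
        (auto simp: add_pos_nonneg)
  qed
  also have "\<dots> \<le> (2 * D) ^ N * cauchy_weight z"
    using cauchy_weight_lower[of z] assms by (intro mult_left_mono) (auto simp: r_def N_def)
  finally have "(c * D powr (t - s)) powr p * (D ^ N / m ^ (2 * N))
      \<le> (c * D powr (t - s)) powr p * ((2 * D) ^ N * cauchy_weight z)"
    by (rule mult_left_mono) simp
  then show ?thesis
    using main by (simp add: r_def N_def mult.assoc)
qed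

lemma nn_integral_lborel_translate:
  fixes f :: "'a::euclidean_space \<Rightarrow> ennreal"
  assumes [measurable]: "f \<in> borel_measurable borel"
  shows "(\<integral>\<^sup>+y. f (y - x) \<partial>lborel) = (\<integral>\<^sup>+y. f y \<partial>lborel)"
proof -
  have "(\<integral>\<^sup>+y. f y \<partial>lborel) = (\<integral>\<^sup>+y. f y \<partial>distr lborel borel ((+) (- x)))"
    by (simp add: lborel_distr_plus)
  also have "\<dots> = (\<integral>\<^sup>+y. f (y - x) \<partial>lborel)"
    by (subst nn_integral_distr) auto
  finally show ?thesis ..
qed

text \<open>
  The integrand vanishes unless one of the two points lies in the bounded set, which makes the dominating
  function integrable over pairs. What matters is that K does not depend on p.
\<close>

lemma gagliardo_energy_bound:
  fixes \<Omega> :: "'a::euclidean_space set"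
  assumes \<Omega>: "\<Omega> \<in> sets borel" "bounded \<Omega>" and t: "0 < s" "s < t" and D: "1 \<le> D" and c: "0 \<le> c"
    and w_meas [measurable]: "w \<in> borel_measurable borel"
    and w: "\<And>x. x \<notin> \<Omega> \<Longrightarrow> w x = 0" "\<And>x. 0 \<le> w x" "\<And>x. w x \<le> c * D powr t"
      "\<And>x y. \<bar>w x - w y\<bar> \<le> c * norm (x - y) powr t"
  obtains K where "0 \<le> K"
    "\<And>p. \<lbrakk>0 < p; real DIM('a) \<le> (t - s) * p; real DIM('a) \<le> s * p\<rbrakk>
      \<Longrightarrow> gagliardo_energy s p w \<le> ennreal (K * (c * D powr (t - s)) powr p)"
proof -
  note [measurable] = \<Omega>(1)
  define H where "H = (\<integral>\<^sup>+z. ennreal (cauchy_weight (z::'a)) \<partial>lborel)"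
  define V where "V = emeasure lborel \<Omega>"
  have H: "H < \<infinity>" using nn_integral_cauchy_weight_finite by (simp add: H_def)
  have V: "V < \<infinity>" using emeasure_bounded_finite[OF \<Omega>(2)] by (simp add: V_def)
  define K where "K = (2 * D) ^ DIM('a) * (2 * enn2real V * enn2real H)"
  have row: "(\<integral>\<^sup>+x. indicator \<Omega> x * (\<integral>\<^sup>+y. ennreal (cauchy_weight (x - y)) \<partial>lborel) \<partial>lborel) = V * H"
  proof -
    have "(\<integral>\<^sup>+y. ennreal (cauchy_weight (x - y)) \<partial>lborel) = H" for x :: 'a
      using nn_integral_lborel_translate[of "\<lambda>z. ennreal (cauchy_weight z)" x]
      by (simp add: H_def cauchy_weight_minus_commute[of x])
    then show ?thesis
      by (simp add: nn_integral_cmult nn_integral_multc V_def)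
  qed
  have col: "(\<integral>\<^sup>+x. \<integral>\<^sup>+y. indicator \<Omega> y * ennreal (cauchy_weight (x - y)) \<partial>lborel \<partial>lborel) = V * H"
  proof -
    have "(\<integral>\<^sup>+x. \<integral>\<^sup>+y. indicator \<Omega> y * ennreal (cauchy_weight (x - y)) \<partial>lborel \<partial>lborel) =
        (\<integral>\<^sup>+y. \<integral>\<^sup>+x. indicator \<Omega> y * ennreal (cauchy_weight (x - y)) \<partial>lborel \<partial>lborel)"
      by (rule lborel_pair.Fubini') measurable
    then show ?thesis
      using row by (simp add: nn_integral_cmult cauchy_weight_minus_commute)
  qed
  show ?thesis
  proof (rule that)
    show "0 \<le> K" using D by (simp add: K_def)
    fix p
    assume p: "0 < p" "real DIM('a) \<le> (t - s) * p" "real DIM('a) \<le> s * p"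
    define A where "A = (c * D powr (t - s)) powr p * (2 * D) ^ DIM('a)"
    have A: "0 \<le> A" using D by (simp add: A_def)
    have pt: "ennreal (\<bar>w x - w y\<bar> powr p / norm (x - y) powr (real DIM('a) + s * p))
        \<le> ennreal A * (indicator \<Omega> x * ennreal (cauchy_weight (x - y))
          + indicator \<Omega> y * ennreal (cauchy_weight (x - y)))" for x y
    proof -
      have cw: "0 \<le> cauchy_weight (x - y)"
        by (simp add: cauchy_weight_def prod_nonneg)
      have "\<bar>w x - w y\<bar> \<le> c * D powr t"
        using w(2,3)[of x] w(2,3)[of y] by linarith
      then have *: "\<bar>w x - w y\<bar> powr p / norm (x - y) powr (real DIM('a) + s * p)
          \<le> A * cauchy_weight (x - y)"
        unfolding A_def using t D c p w(4)
        by (intro gagliardo_integrand_bound[where t = t]) auto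
      consider "x \<notin> \<Omega>" "y \<notin> \<Omega>" | "x \<in> \<Omega> \<or> y \<in> \<Omega>" by auto
      then show ?thesis
      proof cases
        case 1
        then show ?thesis using w(1) p by simp
      next
        case 2
        have "ennreal (\<bar>w x - w y\<bar> powr p / norm (x - y) powr (real DIM('a) + s * p))
            \<le> ennreal A * ennreal (cauchy_weight (x - y))"
          using * A cw by (simp flip: ennreal_mult)
        also have "\<dots> \<le> ennreal A * (indicator \<Omega> x * ennreal (cauchy_weight (x - y))
          + indicator \<Omega> y * ennreal (cauchy_weight (x - y)))"
          using 2 by (intro mult_left_mono) (auto simp: indicator_def)
        finally show ?thesis .
      qed
    qed
    have "gagliardo_energy s p w \<le> (\<integral>\<^sup>+x. \<integral>\<^sup>+y. ennreal A * (indicator \<Omega> x * ennreal (cauchy_weight (x - y))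
          + indicator \<Omega> y * ennreal (cauchy_weight (x - y))) \<partial>lborel \<partial>lborel)"
      unfolding gagliardo_energy_def by (intro nn_integral_mono pt)
    also have "\<dots> = ennreal A * (V * H + V * H)"
      by (simp add: nn_integral_cmult nn_integral_add row col)
    also have "V * H = ennreal (enn2real V * enn2real H)"
      using V H by (simp add: ennreal_mult)
    also have "ennreal A * (ennreal (enn2real V * enn2real H) + ennreal (enn2real V * enn2real H))
        = ennreal (K * (c * D powr (t - s)) powr p)"
      using A by (simp add: K_def A_def ennreal_mult[symmetric] ennreal_plus[symmetric] algebra_simps
          del: ennreal_plus)
    finally show "gagliardo_energy s p w \<le> ennreal (K * (c * D powr (t - s)) powr p)" .
  qed
qed

section \<open>Lower bounds on the energy\<close>

lemma powr_at_top_tendsto_0: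
  fixes q :: real
  assumes "0 < q" "q < 1"
  shows "((\<lambda>x. q powr x) \<longlongrightarrow> 0) at_top"
proof -
  have "filterlim (\<lambda>x. ln q * x) at_bot at_top"
    using assms by (intro filterlim_tendsto_neg_mult_at_bot[OF tendsto_const]) (auto simp: filterlim_ident)
  then have "((\<lambda>x. exp (ln q * x)) \<longlongrightarrow> 0) at_top"
    by (rule filterlim_compose[OF exp_at_bot])
  then show ?thesis
    using assms by (simp add: powr_def mult.commute)
qed

text \<open>
  If the bound failed at a pair (x, y), it would fail, with a margin, on a product of two balls
  around x and y, also for the functions close to g. On this product the integrand is at least \<open>M\<^sup>p\<close> times a
  constant, which outgrows \<open>K a\<^sup>p\<close>.
\<close>

lemma holder_bound_of_energy_growth:
  fixes f :: "nat \<Rightarrow> 'a::euclidean_space \<Rightarrow> real"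
  assumes s: "0 < s" and unif: "uniform_limit UNIV f g sequentially"
    and cont: "continuous_on UNIV g"
    and p: "filterlim p at_top sequentially"
    and a: "0 < a" "a < M" and K: "0 \<le> K"
    and energy: "\<forall>\<^sub>F n in sequentially. gagliardo_energy s (p n) (f n) \<le> ennreal (K * a powr p n)"
  shows "\<bar>g x - g y\<bar> \<le> M * norm (x - y) powr s"
proof (rule ccontr)
  assume neg: "\<not> ?thesis"
  define G where "G = (\<lambda>z. \<bar>g (fst z) - g (snd z)\<bar> - M * norm (fst z - snd z) powr s)"
  have contG: "continuous_on UNIV G"
    unfolding G_def using s
    by (intro continuous_intros continuous_on_powr' continuous_on_compose2[OF cont]) auto
  define \<eta> where "\<eta> = G (x, y) / 2"
  have \<eta>: "0 < \<eta>" "\<eta> < G (x, y)" using neg by (auto simp: \<eta>_def G_def)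
  have "open {z. \<eta> < G z}"
    using contG by (intro open_Collect_less continuous_intros) auto
  then obtain A B where AB: "open A" "open B" "(x, y) \<in> A \<times> B" "A \<times> B \<subseteq> {z. \<eta> < G z}"
    using \<eta>(2) open_prod_elim[of "{z. \<eta> < G z}" "(x, y)"] by blast
  obtain r1 where r1: "0 < r1" "ball x r1 \<subseteq> A" using AB openE[of A x] by auto
  obtain r2 where r2: "0 < r2" "ball y r2 \<subseteq> B" using AB openE[of B y] by auto
  define R where "R = norm (x - y) + r1 + r2"
  have R: "0 < R" using r1 r2 by (simp add: R_def add_nonneg_pos)
  define V where "V = measure lborel (ball x r1) * measure lborel (ball y r2)"
  have V: "0 < V" using r1 r2 by (simp add: V_def content_ball_pos)
  define \<kappa> where "\<kappa> = V / R ^ DIM('a)"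
  have \<kappa>: "0 < \<kappa>" using V R by (simp add: \<kappa>_def)
  have M: "0 < M" using a by simp
  have lower: "ennreal (\<kappa> * M powr q) \<le> gagliardo_energy s q h"
    if q: "0 < q" and h: "\<And>z. dist (h z) (g z) < \<eta> / 2" for q h
  proof -
    define m where "m = M powr q / R ^ DIM('a)"
    have pt: "ennreal m * (indicator (ball x r1) x' * indicator (ball y r2) y')
        \<le> ennreal (\<bar>h x' - h y'\<bar> powr q / norm (x' - y') powr (real DIM('a) + s * q))" for x' y'
    proof (cases "x' \<in> ball x r1 \<and> y' \<in> ball y r2")
      case True
      then have "(x', y') \<in> A \<times> B" using r1 r2 by auto
      then have "\<eta> < \<bar>g x' - g y'\<bar> - M * norm (x' - y') powr s"
        using AB(4) by (auto simp: G_def)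
      then have big: "M * norm (x' - y') powr s < \<bar>h x' - h y'\<bar>"
        using h[of x'] h[of y'] unfolding dist_real_def by linarith
      then have ne: "0 < norm (x' - y')" using M by (cases "x' = y'") auto
      have "norm (x' - y') = norm ((x' - x) + (x - y) + (y - y'))" by simp
      also have "\<dots> \<le> norm (x' - x) + norm (x - y) + norm (y - y')"
        by (meson norm_triangle_le order_refl add_mono)
      also have "\<dots> \<le> R"
        using True by (simp add: R_def dist_norm norm_minus_commute)
      finally have R': "norm (x' - y') \<le> R" .
      have "m \<le> M powr q / norm (x' - y') ^ DIM('a)"
        unfolding m_def using R' ne by (intro divide_left_mono power_mono) (auto simp: R)
      also have "\<dots> = (M * norm (x' - y') powr s) powr q / norm (x' - y') powr (real DIM('a) + s * q)"
        using ne M by (simp add: powr_mult powr_powr powr_add powr_realpow)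
      also have "\<dots> \<le> \<bar>h x' - h y'\<bar> powr q / norm (x' - y') powr (real DIM('a) + s * q)"
        using big q M by (intro divide_right_mono powr_mono2) auto
      finally show ?thesis
        using True by (auto intro: ennreal_leI)
    qed (auto simp: indicator_def)
    have "ennreal (\<kappa> * M powr q) = ennreal m * ennreal V"
      using V M R by (simp add: \<kappa>_def m_def mult.commute flip: ennreal_mult)
    also have "ennreal V = emeasure lborel (ball x r1) * emeasure lborel (ball y r2)"
    proof -
      have "emeasure lborel (ball z r) = ennreal (measure lborel (ball z r))" for z :: 'a and r
        using emeasure_bounded_finite[OF bounded_ball, of z r] by (intro emeasure_eq_ennreal_measure) auto
      then show ?thesis
        by (simp only: V_def ennreal_mult measure_nonneg)
    qed
    also have "ennreal m * \<dots> = (\<integral>\<^sup>+x'. \<integral>\<^sup>+y'. ennreal m *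
        (indicator (ball x r1) x' * indicator (ball y r2) y') \<partial>lborel \<partial>lborel)"
    proof -
      have "(\<integral>\<^sup>+y'. ennreal m * (indicator (ball x r1) x' * indicator (ball y r2) y') \<partial>lborel) =
          ennreal m * emeasure lborel (ball y r2) * indicator (ball x r1) x'" for x'
        using nn_integral_cmult_indicator[of "ball y r2" lborel "ennreal m * indicator (ball x r1) x'"]
        by (simp add: mult_ac)
      then show ?thesis
        using nn_integral_cmult_indicator[of "ball x r1" lborel "ennreal m * emeasure lborel (ball y r2)"]
        by (simp add: mult_ac)
    qed
    also have "\<dots> \<le> gagliardo_energy s q h"
      unfolding gagliardo_energy_def by (intro nn_integral_mono pt)
    finally show ?thesis .
  qed
  have "(\<lambda>n. K * (a / M) powr p n) \<longlonglongrightarrow> K * 0"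
    using a by (intro tendsto_intros filterlim_compose[OF powr_at_top_tendsto_0 p]) auto
  then have "\<forall>\<^sub>F n in sequentially. K * (a / M) powr p n < \<kappa>"
    using \<kappa> by (intro order_tendstoD(2)) auto
  moreover have "\<forall>\<^sub>F n in sequentially. 0 < p n"
    using p by (auto simp: filterlim_at_top_dense)
  moreover have "\<forall>\<^sub>F n in sequentially. \<forall>z\<in>UNIV. dist (f n z) (g z) < \<eta> / 2"
    using unif \<eta> by (intro uniform_limitD) auto
  ultimately have "\<forall>\<^sub>F n in sequentially. False"
    using energy
  proof eventually_elim
    case (elim n)
    have "ennreal (\<kappa> * M powr p n) \<le> ennreal (K * a powr p n)"
      using lower[of "p n" "f n"] elim by (auto intro: order_trans)
    then have "\<kappa> * M powr p n \<le> K * a powr p n"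
      using K by simp
    moreover have "K * (a / M) powr p n * M powr p n = K * a powr p n"
      using a M by (simp add: powr_divide)
    moreover have "K * (a / M) powr p n * M powr p n < \<kappa> * M powr p n"
      using elim(1) M by (intro mult_strict_right_mono) auto
    ultimately show False by linarith
  qed
  then show False by simp
qed

section \<open>The extremal profile\<close>

context weighted_domain
begin

context
  fixes s :: real
  assumes s: "0 < s" "s < 1" and ln_int: "integrable \<mu> (\<lambda>x. ln (bdist x))"
begin

lemma ln_bdist_multiple:
  assumes "0 < c"
  shows "integrable \<mu> (\<lambda>x. ln \<bar>c * bdist x powr t\<bar>)"
    and "(\<integral>x. ln \<bar>c * bdist x powr t\<bar> \<partial>\<mu>) = ln c + t * (\<integral>x. ln (bdist x) \<partial>\<mu>)"
proof -
  have eq: "AE x in \<mu>. ln c + t * ln (bdist x) = ln \<bar>c * bdist x powr t\<bar>"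
    using AE_\<mu>_domain
  proof eventually_elim
    fix x assume "x \<in> \<Omega>"
    then show "ln c + t * ln (bdist x) = ln \<bar>c * bdist x powr t\<bar>"
      using bdist_pos[of x] assms by (simp add: abs_mult ln_mult ln_powr)
  qed
  have int: "integrable \<mu> (\<lambda>x. ln c + t * ln (bdist x))"
    using ln_int by simp
  show "integrable \<mu> (\<lambda>x. ln \<bar>c * bdist x powr t\<bar>)"
    by (rule integrable_cong_AE_imp[OF int _ eq]) simp
  have "(\<integral>x. ln \<bar>c * bdist x powr t\<bar> \<partial>\<mu>) = (\<integral>x. ln c + t * ln (bdist x) \<partial>\<mu>)"
    using eq by (intro integral_cong_AE) auto
  also have "\<dots> = ln c + t * (\<integral>x. ln (bdist x) \<partial>\<mu>)"
    using ln_int \<mu>.prob_space by simp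
  finally show "(\<integral>x. ln \<bar>c * bdist x powr t\<bar> \<partial>\<mu>) = ln c + t * (\<integral>x. ln (bdist x) \<partial>\<mu>)" .
qed

text \<open>
  The factor that normalizes the power t of the distance to logarithmic mean 1.
\<close>

definition "unit_const t = exp (- t * (\<integral>x. ln (bdist x) \<partial>\<mu>))"

lemma unit_const_pos [simp]: "0 < unit_const t" "unit_const t \<noteq> 0" "\<bar>unit_const t\<bar> = unit_const t"
  by (simp_all add: unit_const_def)

lemma log_integral_unit_profile: "log_integral \<Omega> \<omega> (\<lambda>x. unit_const t * bdist x powr t) = 0"
  using ln_bdist_multiple[of "unit_const t" t] bdist_pos
  by (subst log_integral_eq_integral) (force simp: unit_const_def)+

text \<open>
  The competitor is the normalized power of the distance with an exponent t slightly larger than s. By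
  \<open>gagliardo_energy_bound\<close>, its energy grows at most like the p-th power of \<open>unit_const t * D powr (t - s)\<close>, which tends
  to \<open>unit_const s\<close> as t decreases to s.
\<close>

lemma Lambda_growth:
  assumes "unit_const s < a"
  obtains K where "0 \<le> K" "\<forall>\<^sub>F p in at_top. Lambda s p \<Omega> \<omega> \<le> K * a powr p"
proof -
  obtain D where D: "1 \<le> D" "\<And>x. bdist x \<le> D" using bdist_bounded by blast
  have "((\<lambda>t. unit_const t * D powr (t - s)) \<longlongrightarrow> unit_const s * D powr (s - s)) (at_right s)"
    unfolding unit_const_def using D by (intro tendsto_intros) auto
  then have "\<forall>\<^sub>F t in at_right s. unit_const t * D powr (t - s) < a"
    using assms D by (intro order_tendstoD(2)) auto
  moreover have "\<forall>\<^sub>F t in at_right s. t < 1"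
    using s eventually_at_right_field by blast
  moreover have "\<forall>\<^sub>F t in at_right s. s < t"
    by (rule eventually_at_right_less)
  ultimately have "\<forall>\<^sub>F t in at_right s. s < t \<and> t < 1 \<and> unit_const t * D powr (t - s) < a"
    by eventually_elim simp
  then obtain t where t: "s < t" "t < 1" "unit_const t * D powr (t - s) < a"
    using eventually_happens'[OF trivial_limit_at_right_real] by blast
  define w where "w = (\<lambda>x. unit_const t * bdist x powr t)"
  have w_meas [measurable]: "w \<in> borel_measurable borel" unfolding w_def by measurable
  have w: "0 \<le> w x" "w x \<le> unit_const t * D powr t" for x
    using D t s by (auto simp: w_def infdist_nonneg less_imp_le intro!: mult_left_mono powr_mono2)
  have w0: "w x = 0" if "x \<notin> \<Omega>" for x
    using that by (simp add: w_def)
  have w_holder: "\<bar>w x - w y\<bar> \<le> unit_const t * norm (x - y) powr t" for x y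
  proof -
    have "\<bar>w x - w y\<bar> = unit_const t * \<bar>bdist x powr t - bdist y powr t\<bar>"
      by (simp add: w_def abs_mult flip: right_diff_distrib)
    then show ?thesis
      using bdist_powr_holder[of t x y] t s by (simp add: mult_left_mono)
  qed
  obtain K where K: "0 \<le> K" "\<And>p. \<lbrakk>0 < p; real DIM('a) \<le> (t - s) * p; real DIM('a) \<le> s * p\<rbrakk>
      \<Longrightarrow> gagliardo_energy s p w \<le> ennreal (K * (unit_const t * D powr (t - s)) powr p)"
    using gagliardo_energy_bound[OF domain_measurable bounded_domain s(1) t(1) D(1)
        less_imp_le[OF unit_const_pos(1)] w_meas w0 w w_holder] by blast
  have bound: "Lambda s p \<Omega> \<omega> \<le> K * a powr p"
    if p: "max (DIM('a) / (t - s)) (DIM('a) / s) \<le> p" "0 < p" for p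
  proof -
    have energy: "gagliardo_energy s p w \<le> ennreal (K * (unit_const t * D powr (t - s)) powr p)"
      using p t s by (intro K) (auto simp: divide_le_eq mult.commute)
    have "integrable lborel (\<lambda>x. \<bar>w x\<bar> powr p)"
    proof -
      have "integrable lborel (\<lambda>x. (unit_const t * D powr t) powr p * indicator \<Omega> x)"
        using emeasure_bounded_finite[OF bounded_domain] by simp
      then show ?thesis
        by (rule Bochner_Integration.integrable_bound)
          (use w w0 p in \<open>auto intro!: AE_I2 powr_mono2 simp: indicator_def\<close>)
    qed
    moreover have "gagliardo_energy s p w < \<infinity>"
      using energy by (rule le_less_trans) simp
    ultimately have "w \<in> sobolev_zero s p \<Omega>"
      using w_meas w0 by (simp add: sobolev_zero_def)
    then have "w \<in> constraint_p s p \<Omega> \<omega>"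
      using log_integral_unit_profile[of t] by (simp add: constraint_p_def w_def)
    then have "Lambda s p \<Omega> \<omega> \<le> gagliardo_seminorm s p w powr p"
      unfolding Lambda_def by (intro cINF_lower bdd_belowI2[where m = 0]) auto
    also have "\<dots> = enn2real (gagliardo_energy s p w)"
      using p by (simp add: gagliardo_seminorm_def powr_powr)
    also have "\<dots> \<le> K * (unit_const t * D powr (t - s)) powr p"
      using energy K(1) by (intro enn2real_leI) auto
    also have "\<dots> \<le> K * a powr p"
      using t p K(1) by (intro mult_left_mono powr_mono2) (auto simp: less_imp_le)
    finally show ?thesis .
  qed
  have "\<forall>\<^sub>F p in at_top. Lambda s p \<Omega> \<omega> \<le> K * a powr p"
    using eventually_ge_at_top[of "max (DIM('a) / (t - s)) (DIM('a) / s)"] eventually_gt_at_top[of 0]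
    by eventually_elim (rule bound)
  with K(1) show ?thesis by (rule that)
qed

text \<open>
  The profile f on the right has logarithmic mean 1, so a function below it cannot have this
  mean, or be approximated by functions that have it, unless it equals the profile. The hypothesis is
  stated with an approximation v so that it applies to uniform limits as well as (with \<open>v = w\<close>) to
  minimizers. A gap at one point persists on a ball; it would lower the integral of the
  logarithm by a fixed \<open>\<kappa> > 0\<close>, whereas the error made by replacing f by \<open>f + \<epsilon>\<close> tends to 0.
\<close>

lemma abs_eq_profile:
  assumes [measurable]: "w \<in> borel_measurable borel" and cont: "continuous_on \<Omega> w"
    and le: "\<And>x. x \<in> \<Omega> \<Longrightarrow> \<bar>w x\<bar> \<le> unit_const s * bdist x powr s"
    and approx: "\<And>\<epsilon>. 0 < \<epsilon> \<Longrightarrow> \<exists>v\<in>borel_measurable borel. log_integral \<Omega> \<omega> v = 0 \<and> (\<forall>x\<in>\<Omega>. \<bar>v x\<bar> \<le> \<bar>w x\<bar> + \<epsilon>)"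
    and x: "x \<in> \<Omega>"
  shows "\<bar>w x\<bar> = unit_const s * bdist x powr s"
proof (rule ccontr)
  define f where "f = (\<lambda>x. unit_const s * bdist x powr s)"
  have [measurable]: "f \<in> borel_measurable borel" unfolding f_def by measurable
  have f_nonneg: "0 \<le> f y" for y by (simp add: f_def less_imp_le)
  have f_pos: "0 < f y" if "y \<in> \<Omega>" for y using bdist_pos[OF that] by (simp add: f_def)
  obtain D where D: "1 \<le> D" "\<And>x. bdist x \<le> D" using bdist_bounded by blast
  define T where "T = unit_const s * D powr s + 1"
  have T_pos: "0 < T"
    by (simp add: T_def add_nonneg_pos less_imp_le)
  have T: "f y + \<epsilon> \<le> T" if "\<epsilon> \<le> 1" for y \<epsilon>
    using D s that by (auto simp: T_def f_def infdist_nonneg less_imp_le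
        intro!: add_mono mult_left_mono powr_mono2)
  assume "\<not> ?thesis"
  then have gap: "\<bar>w x\<bar> < f x" using le[OF x] by (simp add: f_def)
  define \<delta> where "\<delta> = (f x - \<bar>w x\<bar>) / 2"
  have \<delta>: "0 < \<delta>" "\<delta> < f x - \<bar>w x\<bar>" using gap by (auto simp: \<delta>_def)
  have "continuous_on \<Omega> (\<lambda>y. f y - \<bar>w y\<bar>)"
    unfolding f_def using s by (intro continuous_intros continuous_on_powr' cont) (auto simp: infdist_nonneg)
  then have open_gap: "open ((\<lambda>y. f y - \<bar>w y\<bar>) -` {\<delta><..} \<inter> \<Omega>)"
    using continuous_on_open_vimage[OF open_domain] open_greaterThan by blast
  have "x \<in> (\<lambda>y. f y - \<bar>w y\<bar>) -` {\<delta><..} \<inter> \<Omega>"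
    using x \<delta> by simp
  then obtain r where r: "0 < r" "ball x r \<subseteq> (\<lambda>y. f y - \<bar>w y\<bar>) -` {\<delta><..} \<inter> \<Omega>"
    by (rule openE[OF open_gap])
  define \<kappa> where "\<kappa> = \<delta> / T * measure \<mu> (ball x r)"
  have \<kappa>: "0 < \<kappa>"
    using \<delta> T_pos r \<mu>_ball_pos[of r x] by (auto simp: \<kappa>_def)
  have int: "integrable \<mu> (\<lambda>x. ln (f x + \<epsilon>))" if "0 < \<epsilon>" "\<epsilon> \<le> 1" for \<epsilon>
  proof (rule \<mu>.integrable_const_bound)
    show "AE y in \<mu>. norm (ln (f y + \<epsilon>)) \<le> \<bar>ln \<epsilon>\<bar> + \<bar>ln T\<bar>"
    proof (rule AE_I2)
      fix y
      have "ln \<epsilon> \<le> ln (f y + \<epsilon>)" "ln (f y + \<epsilon>) \<le> ln T"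
        using that f_nonneg[of y] T[of \<epsilon> y] by (auto simp: add_nonneg_pos)
      then show "norm (ln (f y + \<epsilon>)) \<le> \<bar>ln \<epsilon>\<bar> + \<bar>ln T\<bar>" unfolding real_norm_def by linarith
    qed
  qed simp
  have ball_int: "integrable \<mu> (\<lambda>y. \<delta> / T * indicator (ball x r) y)"
    by (intro integrable_mult_right integrable_real_indicator) (auto simp: \<mu>.emeasure_eq_measure)
  have lower: "\<kappa> \<le> (\<integral>x. ln (f x + \<epsilon>) \<partial>\<mu>)" if \<epsilon>: "0 < \<epsilon>" "\<epsilon> \<le> 1" for \<epsilon>
  proof -
    obtain v where [measurable]: "v \<in> borel_measurable borel" and zero: "log_integral \<Omega> \<omega> v = 0"
      and v: "\<And>x. x \<in> \<Omega> \<Longrightarrow> \<bar>v x\<bar> \<le> \<bar>w x\<bar> + \<epsilon>"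
      using approx[OF \<epsilon>(1)] by blast
    note log = log_integral_zeroD[OF _ zero, simplified]
    have "0 = (\<integral>x. ln \<bar>v x\<bar> \<partial>\<mu>)" using log(3) by simp
    also have "\<dots> \<le> (\<integral>y. ln (f y + \<epsilon>) - \<delta> / T * indicator (ball x r) y \<partial>\<mu>)"
    proof (rule integral_mono_AE)
      show "AE y in \<mu>. ln \<bar>v y\<bar> \<le> ln (f y + \<epsilon>) - \<delta> / T * indicator (ball x r) y"
        using log(1) AE_\<mu>_domain
      proof eventually_elim
        fix y assume y: "v y \<noteq> 0" "y \<in> \<Omega>"
        show "ln \<bar>v y\<bar> \<le> ln (f y + \<epsilon>) - \<delta> / T * indicator (ball x r) y"
        proof (cases "y \<in> ball x r")
          case False
          have "\<bar>v y\<bar> \<le> f y + \<epsilon>" using v[OF y(2)] le[OF y(2)] by (simp add: f_def)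
          then show ?thesis using y False by simp
        next
          case True
          then have "\<delta> < f y - \<bar>w y\<bar>" using r(2) by auto
          then have vy: "\<bar>v y\<bar> \<le> f y + \<epsilon> - \<delta>" using v[OF y(2)] by simp
          define q where "q = f y + \<epsilon>"
          have q: "0 < q" "q \<le> T" "\<delta> < q"
            using f_pos[OF y(2)] \<epsilon> T[of \<epsilon> y] vy y(1) by (auto simp: q_def)
          have "ln \<bar>v y\<bar> \<le> ln (q - \<delta>)" using vy y(1) by (simp add: q_def)
          also have "\<dots> = ln q + ln (1 - \<delta> / q)"
          proof -
            have "q - \<delta> = q * (1 - \<delta> / q)" "0 < 1 - \<delta> / q"
              using q by (simp_all add: right_diff_distrib)
            then show ?thesis using q by (simp only: ln_mult_pos)
          qed
          also have "ln (1 - \<delta> / q) \<le> - (\<delta> / q)"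
            using q \<delta> ln_le_minus_one[of "1 - \<delta> / q"] by simp
          also have "- (\<delta> / q) \<le> - (\<delta> / T)"
            using q \<delta> T_pos by (simp add: divide_left_mono)
          finally show ?thesis using True by (simp add: q_def)
        qed
      qed
    qed (intro log(2), intro Bochner_Integration.integrable_diff int[OF \<epsilon>] ball_int)
    also have "\<dots> = (\<integral>x. ln (f x + \<epsilon>) \<partial>\<mu>) - \<kappa>"
      by (subst Bochner_Integration.integral_diff[OF int[OF \<epsilon>] ball_int]) (simp add: \<kappa>_def)
    finally show ?thesis by simp
  qed
  have ln_f: "integrable \<mu> (\<lambda>x. ln (f x))" "(\<integral>x. ln (f x) \<partial>\<mu>) = 0"
    using ln_bdist_multiple[of "unit_const s" s] f_nonneg by (simp_all add: f_def unit_const_def)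
  have "(\<lambda>n. \<integral>x. ln (f x + 1 / Suc n) \<partial>\<mu>) \<longlonglongrightarrow> (\<integral>x. ln (f x) \<partial>\<mu>)"
  proof (rule integral_dominated_convergence)
    show "integrable \<mu> (\<lambda>x. \<bar>ln (f x)\<bar> + \<bar>ln T\<bar>)"
      using ln_f by auto
    have "(\<lambda>n. ln (f y + 1 / Suc n)) \<longlonglongrightarrow> ln (f y)" if "y \<in> \<Omega>" for y
    proof -
      have "(\<lambda>n. ln (f y + 1 / Suc n)) \<longlonglongrightarrow> ln (f y + 0)"
        using f_pos[OF that] LIMSEQ_Suc[OF lim_1_over_n] by (intro tendsto_intros) auto
      then show ?thesis by simp
    qed
    then show "AE y in \<mu>. (\<lambda>n. ln (f y + 1 / Suc n)) \<longlonglongrightarrow> ln (f y)"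
      using AE_\<mu>_domain by (auto elim!: eventually_mono)
    fix n
    show "AE y in \<mu>. norm (ln (f y + 1 / Suc n)) \<le> \<bar>ln (f y)\<bar> + \<bar>ln T\<bar>"
      using AE_\<mu>_domain
    proof eventually_elim
      fix y assume "y \<in> \<Omega>"
      then have "ln (f y) \<le> ln (f y + 1 / Suc n)" "ln (f y + 1 / Suc n) \<le> ln T"
        using f_pos[of y] T[of "1 / Suc n" y] by (auto intro!: ln_mono add_pos_pos)
      then show "norm (ln (f y + 1 / Suc n)) \<le> \<bar>ln (f y)\<bar> + \<bar>ln T\<bar>"
        unfolding real_norm_def by linarith
    qed
  qed simp_all
  then have "\<kappa> \<le> 0"
    unfolding ln_f(2) by (rule LIMSEQ_le_const) (use lower in auto)
  then show False using \<kappa> by simp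
qed

lemma profile_in_constraint: "(\<lambda>x. unit_const s * bdist x powr s) \<in> constraint_s s \<Omega> \<omega>"
  using bdist_multiple_holder(1)[of s "unit_const s"] log_integral_unit_profile[of s] s
  by (simp add: constraint_s_def log_mean_eq_1_iff less_imp_le)

text \<open>
  Integrate the logarithm of the bound \<open>\<bar>w\<bar> \<le> \<bar>w\<bar>\<^sub>s d\<^sup>s\<close>.
\<close>

lemma unit_const_le_holder_norm:
  assumes "w \<in> constraint_s s \<Omega> \<omega>"
  shows "unit_const s \<le> holder_norm s \<Omega> w"
proof -
  define h where "h = holder_norm s \<Omega> w"
  have w: "w \<in> holder_zero s \<Omega>" and zero: "log_integral \<Omega> \<omega> w = 0"
    using assms by (auto simp: constraint_s_def log_mean_eq_1_iff)
  have meas [measurable]: "w \<in> borel_measurable borel"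
    by (rule holder_zero_measurable[OF w s(1)])
  note log = log_integral_zeroD[OF meas zero]
  have le: "\<bar>w x\<bar> \<le> h * bdist x powr s" for x
    unfolding h_def by (rule holder_zero_le_bdist[OF w])
  have "AE x in \<mu>. 0 < h"
    using log(1) AE_\<mu>_domain
  proof eventually_elim
    fix x assume "w x \<noteq> 0" "x \<in> \<Omega>"
    then have "0 < h * bdist x powr s"
      by (intro less_le_trans[OF _ le]) simp
    then show "0 < h"
      by (simp add: zero_less_mult_iff)
  qed
  then have h: "0 < h" using \<mu>.AE_const by simp
  have "0 = (\<integral>x. ln \<bar>w x\<bar> \<partial>\<mu>)" using log(3) by simp
  also have "\<dots> \<le> (\<integral>x. ln \<bar>h * bdist x powr s\<bar> \<partial>\<mu>)"
  proof (rule integral_mono_AE)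
    show "AE x in \<mu>. ln \<bar>w x\<bar> \<le> ln \<bar>h * bdist x powr s\<bar>"
      using log(1)
    proof eventually_elim
      fix x assume "w x \<noteq> 0"
      then show "ln \<bar>w x\<bar> \<le> ln \<bar>h * bdist x powr s\<bar>"
        using le[of x] by (intro ln_mono) auto
    qed
  qed (use log(2) ln_bdist_multiple(1)[OF h] in auto)
  also have "\<dots> = ln h + s * (\<integral>x. ln (bdist x) \<partial>\<mu>)"
    by (rule ln_bdist_multiple(2)[OF h])
  finally have "ln (unit_const s) \<le> ln h"
    by (simp add: unit_const_def)
  then show ?thesis using h by (simp add: h_def)
qed

text \<open>
  A minimizer has norm at most that of the profile, so its modulus is the profile by
  \<open>abs_eq_profile\<close>. It has no zeros in the domain, and by connectedness it does not change sign.
\<close>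

lemma minimizers_eq_profile:
  assumes connected: "connected \<Omega>"
  shows "{w. holder_minimizer s \<Omega> \<omega> w} =
    {(\<lambda>x. - (unit_const s * bdist x powr s)), (\<lambda>x. unit_const s * bdist x powr s)}" (is "_ = {?N, ?P}")
proof (intro equalityI subsetI)
  fix w assume "w \<in> {w. holder_minimizer s \<Omega> \<omega> w}"
  then have min: "holder_minimizer s \<Omega> \<omega> w" by simp
  then have "w \<in> constraint_s s \<Omega> \<omega>" by (simp add: is_arg_min_def)
  then have w: "w \<in> holder_zero s \<Omega>" and zero: "log_integral \<Omega> \<omega> w = 0"
    by (auto simp: constraint_s_def log_mean_eq_1_iff)
  have meas: "w \<in> borel_measurable borel" and cont: "continuous_on \<Omega> w"
    by (rule holder_zero_measurable[OF w s(1)], rule holder_zero_continuous[OF w s(1)])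
  have "holder_norm s \<Omega> w \<le> holder_norm s \<Omega> ?P"
    using min profile_in_constraint by (auto simp: is_arg_min_def not_less)
  then have norm: "holder_norm s \<Omega> w \<le> unit_const s"
    using bdist_multiple_holder(2)[of s "unit_const s"] s by (simp add: less_imp_le)
  have "\<bar>w x\<bar> \<le> unit_const s * bdist x powr s" for x
    using holder_zero_le_bdist[OF w, of x] mult_right_mono[OF norm, of "bdist x powr s"] by simp
  then have abs: "\<bar>w x\<bar> = unit_const s * bdist x powr s" if "x \<in> \<Omega>" for x
    using that meas zero by (intro abs_eq_profile[OF meas cont]) (auto intro!: bexI[of _ w])
  have nz: "w x \<noteq> 0" if "x \<in> \<Omega>" for x
    using abs[OF that] bdist_pos[OF that] by auto
  have out: "w x = 0" "bdist x = 0" if "x \<notin> \<Omega>" for x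
    using that w by (auto simp: holder_zero_def)
  have "connected (w ` \<Omega>)"
    using connected cont by (intro connected_continuous_image)
  then have "(\<forall>x\<in>\<Omega>. 0 < w x) \<or> (\<forall>x\<in>\<Omega>. w x < 0)"
  proof (rule contrapos_pp)
    assume "\<not> ((\<forall>x\<in>\<Omega>. 0 < w x) \<or> (\<forall>x\<in>\<Omega>. w x < 0))"
    then obtain x y where xy: "x \<in> \<Omega>" "w x \<le> 0" "y \<in> \<Omega>" "0 \<le> w y"
      by (auto simp: not_less)
    show "\<not> connected (w ` \<Omega>)"
    proof
      assume "connected (w ` \<Omega>)"
      then have "0 \<in> w ` \<Omega>"
        by (rule connectedD_interval[of _ "w x" "w y"]) (use xy in auto)
      then show False using nz by auto
    qed
  qed
  then show "w \<in> {?N, ?P}"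
  proof
    assume "\<forall>x\<in>\<Omega>. 0 < w x"
    then have "w x = ?P x" for x using abs[of x] out[of x] by (cases "x \<in> \<Omega>") auto
    then show ?thesis by auto
  next
    assume "\<forall>x\<in>\<Omega>. w x < 0"
    then have "w x = ?N x" for x using abs[of x] out[of x] by (cases "x \<in> \<Omega>") auto
    then show ?thesis by auto
  qed
next
  have abs_norm: "holder_norm s \<Omega> ?N = unit_const s" "holder_norm s \<Omega> ?P = unit_const s"
    using bdist_multiple_holder(2)[of s "unit_const s"] s
    by (simp_all add: less_imp_le holder_norm_uminus)
  have "?N \<in> constraint_s s \<Omega> \<omega>"
  proof -
    have "log_integral \<Omega> \<omega> ?N = log_integral \<Omega> \<omega> ?P" by (simp add: log_integral_def)
    then show ?thesis
      using profile_in_constraint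
      by (auto simp: constraint_s_def log_mean_def holder_zero_def abs_minus_commute)
  qed
  then show "w \<in> {w. holder_minimizer s \<Omega> \<omega> w}" if "w \<in> {?N, ?P}" for w
    using that profile_in_constraint unit_const_le_holder_norm abs_norm
    by (auto simp: is_arg_min_def not_less)
qed

end

end

section \<open>The limit function\<close>

theorem theorem15:
  fixes \<Omega> :: "'a::euclidean_space set" and \<omega> :: "'a \<Rightarrow> real" and s :: real
    and u :: "real \<Rightarrow> 'a \<Rightarrow> real" and p :: "nat \<Rightarrow> real"
    and u_inf v_s :: "'a \<Rightarrow> real"
  assumes "bounded_lipschitz_domain \<Omega>" and "0 < s" and "s < 1"
    and "admissible_weight \<Omega> \<omega>"
    and u_p: "\<And>q. q > 1 \<Longrightarrow> extremal s q \<Omega> \<omega> (u q)"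
    and v_s: "holder_minimizer s \<Omega> \<omega> v_s" "\<And>x. v_s x \<ge> 0"
    and p_n: "\<And>n. p n > 1" "filterlim p at_top sequentially"
    and u_inf: "uniform_limit (closure \<Omega>) (\<lambda>n. u (p n)) u_inf sequentially"
      "\<And>x. x \<notin> \<Omega> \<Longrightarrow> u_inf x = 0"
  shows "u_inf \<in> holder_zero s \<Omega>
    \<and> viscosity_supersolution \<Omega> (L_inf s) u_inf
    \<and> viscosity_solution \<Omega> (\<lambda>\<phi> x. L_inf_minus s \<phi> x + holder_norm s \<Omega> u_inf) u_inf
    \<and> (\<forall>x\<in>\<Omega>. u_inf x > 0)
    \<and> {w. holder_minimizer s \<Omega> \<omega> w} = {(\<lambda>x. - v_s x), v_s}"
proof -
  note s = \<open>0 < s\<close> \<open>s < 1\<close>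
  interpret weighted_domain \<Omega> \<omega>
    using assms(1,4) by unfold_locales (auto simp: bounded_lipschitz_domain_def)
  have ln_int: "integrable \<mu> (\<lambda>x. ln (bdist x))"
    using v_s(1) s by (intro integrable_ln_bdist[of s v_s]) (auto simp: is_arg_min_def)
  define L where "L = unit_const s"
  have L: "0 < L" unfolding L_def by (rule unit_const_pos[OF s ln_int])
  have f: "u (p n) \<in> borel_measurable borel" "log_integral \<Omega> \<omega> (u (p n)) = 0"
    "gagliardo_energy s (p n) (u (p n)) = ennreal (Lambda s (p n) \<Omega> \<omega>)"
    "x \<notin> \<Omega> \<Longrightarrow> u (p n) x = 0" "0 \<le> u (p n) x"
    "real DIM('a) < s * p n \<Longrightarrow> continuous_on UNIV (u (p n))" for n x
  proof -
    have ex: "extremal s (p n) \<Omega> \<omega> (u (p n))" and p1: "1 < p n" using u_p p_n(1) by auto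
    have mem: "u (p n) \<in> sobolev_zero s (p n) \<Omega>"
      using ex by (simp add: extremal_def constraint_p_def)
    then show "u (p n) \<in> borel_measurable borel" and out: "x \<notin> \<Omega> \<Longrightarrow> u (p n) x = 0" for x
      by (auto simp: sobolev_zero_def)
    show "0 \<le> u (p n) x"
      using ex out[of x] by (cases "x \<in> \<Omega>") (auto simp: extremal_def less_imp_le)
    show "log_integral \<Omega> \<omega> (u (p n)) = 0" "real DIM('a) < s * p n \<Longrightarrow> continuous_on UNIV (u (p n))"
      using ex by (auto simp: extremal_def constraint_p_def)
    have "Lambda s (p n) \<Omega> \<omega> = enn2real (gagliardo_energy s (p n) (u (p n)))"
      using ex p1 by (auto simp: extremal_def gagliardo_seminorm_def powr_powr)
    then show "gagliardo_energy s (p n) (u (p n)) = ennreal (Lambda s (p n) \<Omega> \<omega>)"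
      using mem by (simp add: sobolev_zero_def)
  qed
  have unif: "uniform_limit UNIV (\<lambda>n. u (p n)) u_inf sequentially"
  proof (rule uniform_limitI)
    fix e :: real assume e: "0 < e"
    then have "\<forall>\<^sub>F n in sequentially. \<forall>x\<in>closure \<Omega>. dist (u (p n) x) (u_inf x) < e"
      by (rule uniform_limitD[OF u_inf(1)])
    then show "\<forall>\<^sub>F n in sequentially. \<forall>x\<in>UNIV. dist (u (p n) x) (u_inf x) < e"
    proof eventually_elim
      case (elim n)
      have "dist (u (p n) x) (u_inf x) < e" for x
        using elim closure_subset[of \<Omega>] f(4)[of x n] u_inf(2)[of x] e by (cases "x \<in> \<Omega>") auto
      then show ?case by blast
    qed
  qed
  have "\<forall>\<^sub>F n in sequentially. real DIM('a) / s < p n"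
    using p_n(2) by (simp add: filterlim_at_top_dense)
  then have "\<forall>\<^sub>F n in sequentially. continuous_on UNIV (u (p n))"
    by eventually_elim (use s in \<open>auto intro!: f(6) simp: divide_less_eq mult.commute\<close>)
  then have cont: "continuous_on UNIV u_inf"
    by (rule uniform_limit_theorem[OF _ unif]) simp
  have nonneg: "0 \<le> u_inf x" for x
    using tendsto_uniform_limitI[OF unif, of x] f(5) by (intro LIMSEQ_le_const) auto
  \<comment> \<open>For \<open>M > L\<close> there is room for a growth rate a strictly between the two.\<close>
  have holder_gt: "\<bar>u_inf x - u_inf y\<bar> \<le> M * norm (x - y) powr s" if M: "L < M" for x y M
  proof -
    obtain a where a: "L < a" "a < M" using dense[OF M] by blast
    obtain K where K: "0 \<le> K" "\<forall>\<^sub>F q in at_top. Lambda s q \<Omega> \<omega> \<le> K * a powr q"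
      using Lambda_growth[OF s ln_int a(1)[unfolded L_def]] .
    have "\<forall>\<^sub>F n in sequentially. Lambda s (p n) \<Omega> \<omega> \<le> K * a powr p n"
      using eventually_compose_filterlim[OF K(2) p_n(2)] .
    then have "\<forall>\<^sub>F n in sequentially. gagliardo_energy s (p n) (u (p n)) \<le> ennreal (K * a powr p n)"
      by eventually_elim (simp add: f(3) ennreal_leI)
    then show ?thesis
      using a L by (intro holder_bound_of_energy_growth[OF s(1) unif cont p_n(2) _ a(2) K(1)]) auto
  qed
  have holder: "\<bar>u_inf x - u_inf y\<bar> \<le> L * norm (x - y) powr s" for x y
  proof -
    have "((\<lambda>M. M * norm (x - y) powr s) \<longlongrightarrow> L * norm (x - y) powr s) (at_right L)"
      by (intro tendsto_intros)
    moreover have "\<forall>\<^sub>F M in at_right L. \<bar>u_inf x - u_inf y\<bar> \<le> M * norm (x - y) powr s"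
      using eventually_at_right_less[of L] by eventually_elim (rule holder_gt)
    ultimately show ?thesis
      by (rule tendsto_lowerbound) simp
  qed
  then have u_holder: "u_inf \<in> holder_zero s \<Omega>"
    using u_inf(2) by (auto simp: holder_zero_def)
  have "holder_norm s \<Omega> u_inf \<le> L"
    by (rule holder_norm_least) (rule holder)
  then have le: "\<bar>u_inf x\<bar> \<le> L * bdist x powr s" for x
    using holder_zero_le_bdist[OF u_holder, of x]
      mult_right_mono[of "holder_norm s \<Omega> u_inf" L "bdist x powr s"] by simp
  \<comment> \<open>The functions of the sequence are the approximations that \<open>abs_eq_profile\<close> asks for.\<close>
  have "\<exists>v\<in>borel_measurable borel. log_integral \<Omega> \<omega> v = 0 \<and> (\<forall>x\<in>\<Omega>. \<bar>v x\<bar> \<le> \<bar>u_inf x\<bar> + \<epsilon>)"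
    if \<epsilon>: "0 < \<epsilon>" for \<epsilon>
  proof -
    obtain n where n: "\<And>x. dist (u (p n) x) (u_inf x) < \<epsilon>"
      using eventually_happens'[OF _ uniform_limitD[OF unif \<epsilon>]] by auto
    have "\<bar>u (p n) x\<bar> \<le> \<bar>u_inf x\<bar> + \<epsilon>" for x
      using n[of x] unfolding dist_real_def by linarith
    then show ?thesis using f(1,2) by blast
  qed
  then have abs: "\<bar>u_inf x\<bar> = L * bdist x powr s" if "x \<in> \<Omega>" for x
    using le that cont unfolding L_def
    by (intro abs_eq_profile[OF s ln_int])
      (auto intro: borel_measurable_continuous_onI continuous_on_subset)
  have "u_inf x = L * bdist x powr s" for x
    using abs[of x] nonneg[of x] u_inf(2)[of x] s by (cases "x \<in> \<Omega>") auto
  then have u_eq: "u_inf = (\<lambda>x. L * bdist x powr s)" by blast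
  have norm: "holder_norm s \<Omega> u_inf = L"
    unfolding u_eq using s L by (intro bdist_multiple_holder) auto
  have s': "s \<le> 1" using s by simp
  note cone = cone_profile_supersolution[OF s(1) s' L] cone_profile_solution[OF s(1) s' L]
  have "cone_profile s L = u_inf"
    by (simp add: u_eq fun_eq_iff cone_profile_def[OF s(1) s' L])
  then have visc: "viscosity_supersolution \<Omega> (L_inf s) u_inf"
    "viscosity_solution \<Omega> (\<lambda>\<phi> x. L_inf_minus s \<phi> x + holder_norm s \<Omega> u_inf) u_inf"
    using cone by (simp_all add: norm)
  then have pos: "\<forall>x\<in>\<Omega>. 0 < u_inf x"
    by (simp add: viscosity_supersolution_def viscosity_candidate_def)
  have mins: "{w. holder_minimizer s \<Omega> \<omega> w} = {(\<lambda>x. - u_inf x), u_inf}"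
    using minimizers_eq_profile[OF s ln_int] assms(1)
    by (simp add: u_eq L_def bounded_lipschitz_domain_def)
  obtain x where "x \<in> \<Omega>" using domain_nonempty by auto
  then have "v_s \<noteq> (\<lambda>x. - u_inf x)"
    using v_s(2)[of x] pos by auto
  moreover have "v_s \<in> {(\<lambda>x. - u_inf x), u_inf}"
    using v_s(1) mins by blast
  ultimately have "v_s = u_inf" by simp
  then show ?thesis
    using u_holder visc pos mins by simp
qed

end
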